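(* Let $q$ be an even prime power, let $\mathrm{AG}(3,q)$ be completed to $\mathrm{PG}(3,q)$ by the plane at infinity $\pi_\infty$, and let $\mathcal{C}$ be a non-singular conic in $\pi_\infty$. Let $\mathcal{L}$ be a Kakeya line set in $T^{*}_{2}(\mathcal{C})$ with corresponding Kakeya set $\mathcal{K}(\mathcal{L})$. If $|\mathcal{K}(\mathcal{L})|<\frac34 q^2+q-1$, then $\mathcal{K}(\mathcal{L})$ is a Kakeya set of the following type: there exist a hyperbolic quadric $\mathcal{Q}$ of $\mathrm{PG}(3,q)$ with $\mathcal{Q}\cap\pi_\infty=\mathcal{C}$, with reguli $\mathcal{R}$ and $\mathcal{R}'$, and a partition of the points of $\mathcal{C}$ into two (possibly empty) sets $A$ and $B$, such that $\mathcal{K}(\mathcal{L})$ is the set of affine points covered by the Kakeya line set consisting of the (affine parts of the) lines of $\mathcal{R}$ through the points of $A$ and the lines of $\mathcal{R}'$ through the points of $B$.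
   Context: The linear representation $T^{*}_{2}(\mathcal{C})$ is the point-line geometry whose points are the points of $\mathrm{AG}(3,q)$, whose lines are the lines of $\mathrm{AG}(3,q)$ whose direction (point at infinity) lies in $\mathcal{C}$, with incidence inherited from $\mathrm{AG}(3,q)$. A Kakeya line set in $T^{*}_{2}(\mathcal{C})$ is a set of lines of $T^{*}_{2}(\mathcal{C})$ containing precisely one line through each point of $\mathcal{C}$; its Kakeya set $\mathcal{K}(\mathcal{L})$ is the set of affine points covered by its lines. A hyperbolic quadric in $\mathrm{PG}(3,q)$ is a quadric projectively equivalent to $X_0X_1+X_2X_3=0$; its $2(q+1)$ lines split into two reguli $\mathcal{R},\mathcal{R}'$ of $q+1$ pairwise disjoint lines each, every line of $\mathcal{R}$ meeting every line of $\mathcal{R}'$. If $\mathcal{Q}\cap\pi_\infty=\mathcal{C}$, each point of $\mathcal{C}$ lies on exactly one line of $\mathcal{R}$ and one line of $\mathcal{R}'$. *)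

theory Defs
  imports "HOL-Analysis.Cartesian_Space"
begin

text \<open>
  Subspaces of \<open>PG(3,q)\<close> are the linear subspaces of \<open>'a ^ 4\<close>, where \<open>'a\<close> is a finite field of
  order \<open>q\<close>, and incidence is inclusion. \<open>AG(3,q)\<close> is \<open>PG(3,q)\<close> without a plane \<open>\<pi>\<close>, which is its
  plane at infinity. An affine line is represented by its projective completion, so its direction
  is its intersection with \<open>\<pi>\<close>.
\<close>

definition pg_points :: "('a::field ^ 4) set set" where
  "pg_points = {P. vec.subspace P \<and> vec.dim P = 1}"

definition pg_lines :: "('a::field ^ 4) set set" where
  "pg_lines = {l. vec.subspace l \<and> vec.dim l = 2}"

definition pg_planes :: "('a::field ^ 4) set set" where
  "pg_planes = {p. vec.subspace p \<and> vec.dim p = 3}"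

definition affine_points :: "('a::field ^ 4) set \<Rightarrow> ('a ^ 4) set set" where
  "affine_points \<pi> = {P \<in> pg_points. \<not> P \<subseteq> \<pi>}"

definition affine_lines :: "('a::field ^ 4) set \<Rightarrow> ('a ^ 4) set set" where
  "affine_lines \<pi> = {l \<in> pg_lines. \<not> l \<subseteq> \<pi>}"

definition zero_points :: "('a::field ^ 4 \<Rightarrow> 'a) \<Rightarrow> ('a ^ 4) set set" where
  "zero_points F = {P \<in> pg_points. \<forall>x\<in>P. F x = 0}"

definition quadratic_form :: "('a::field ^ 4 \<Rightarrow> 'a) \<Rightarrow> bool" where
  "quadratic_form F \<longleftrightarrow>
    (\<exists>c :: 'a ^ 4 ^ 4. \<forall>x. F x = (\<Sum>i\<in>UNIV. \<Sum>j\<in>UNIV. c $ i $ j * x $ i * x $ j))"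

text \<open>
  A singular point of \<open>F = 0\<close> in \<open>\<pi>\<close> is spanned by a zero \<open>v\<close> of \<open>F\<close> at which all derivatives of
  \<open>F\<close> along \<open>\<pi>\<close> vanish; the derivative at \<open>v\<close> in direction \<open>w\<close> is the polar form
  \<open>F (v + w) - F v - F w\<close>. This is meaningful in every characteristic, and over a finite field it is
  equivalent to the absence of singular points over the algebraic closure.
\<close>

definition nonsingular_on :: "('a::field ^ 4) set \<Rightarrow> ('a ^ 4 \<Rightarrow> 'a) \<Rightarrow> bool" where
  "nonsingular_on \<pi> F \<longleftrightarrow>
    (\<forall>v\<in>\<pi>. v \<noteq> 0 \<and> F v = 0 \<longrightarrow> (\<exists>w\<in>\<pi>. F (v + w) - F v - F w \<noteq> 0))"

text \<open>Every quadratic form on the plane \<open>\<pi>\<close> is the restriction of one on the whole space.\<close>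

definition nonsingular_conic :: "('a::field ^ 4) set \<Rightarrow> ('a ^ 4) set set \<Rightarrow> bool" where
  "nonsingular_conic \<pi> C \<longleftrightarrow>
    (\<exists>F. quadratic_form F \<and> nonsingular_on \<pi> F \<and> C = {P \<in> zero_points F. P \<subseteq> \<pi>})"

text \<open>
  The index type \<open>4\<close> has the elements \<open>0, 1, 2, 3\<close>. Projectivities suffice here: field automorphisms
  fix the standard form.
\<close>

definition hyperbolic_quadric :: "('a::field ^ 4) set set \<Rightarrow> bool" where
  "hyperbolic_quadric Q \<longleftrightarrow>
    (\<exists>M :: 'a ^ 4 ^ 4. invertible M \<and>
      Q = (\<lambda>P. (\<lambda>x. M *v x) ` P) ` zero_points (\<lambda>x. x $ 0 * x $ 1 + x $ 2 * x $ 3))"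

definition lines_of :: "('a::field ^ 4) set set \<Rightarrow> ('a ^ 4) set set" where
  "lines_of Q = {l \<in> pg_lines. \<forall>P\<in>pg_points. P \<subseteq> l \<longrightarrow> P \<in> Q}"

text \<open>Two subspaces are disjoint as sets of projective points iff their intersection is \<open>{0}\<close>.\<close>

definition reguli_of ::
  "('a::field ^ 4) set set \<Rightarrow> ('a ^ 4) set set \<Rightarrow> ('a ^ 4) set set \<Rightarrow> bool" where
  "reguli_of Q R R' \<longleftrightarrow>
    R \<union> R' = lines_of Q \<and> R \<inter> R' = {} \<and>
    card R = CARD('a) + 1 \<and> card R' = CARD('a) + 1 \<and>
    (\<forall>l\<in>R. \<forall>m\<in>R. l \<noteq> m \<longrightarrow> l \<inter> m = {0}) \<and>
    (\<forall>l\<in>R'. \<forall>m\<in>R'. l \<noteq> m \<longrightarrow> l \<inter> m = {0}) \<and>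
    (\<forall>l\<in>R. \<forall>m\<in>R'. l \<inter> m \<noteq> {0})"

definition linear_representation_lines ::
  "('a::field ^ 4) set \<Rightarrow> ('a ^ 4) set set \<Rightarrow> ('a ^ 4) set set" where
  "linear_representation_lines \<pi> C = {l \<in> affine_lines \<pi>. l \<inter> \<pi> \<in> C}"

definition kakeya_line_set ::
  "('a::field ^ 4) set \<Rightarrow> ('a ^ 4) set set \<Rightarrow> ('a ^ 4) set set \<Rightarrow> bool" where
  "kakeya_line_set \<pi> C L \<longleftrightarrow>
    L \<subseteq> linear_representation_lines \<pi> C \<and> (\<forall>P\<in>C. \<exists>!l. l \<in> L \<and> P \<subseteq> l)"

definition kakeya_set :: "('a::field ^ 4) set \<Rightarrow> ('a ^ 4) set set \<Rightarrow> ('a ^ 4) set set" where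
  "kakeya_set \<pi> L = {P \<in> affine_points \<pi>. \<exists>l\<in>L. P \<subseteq> l}"

definition lines_through ::
  "('a::field ^ 4) set set \<Rightarrow> ('a ^ 4) set set \<Rightarrow> ('a ^ 4) set set" where
  "lines_through R A = {l \<in> R. \<exists>P\<in>A. P \<subseteq> l}"

end

theory Submission
  imports Defs "HOL-Analysis.Convex" "HOL-Library.Disjoint_Sets" "HOL-Library.Numeral_Type"
begin

text \<open>
  Let \<open>w\<close> be a linear form with kernel \<open>\<pi>\<close>; affine points are the vectors \<open>a\<close> with \<open>w a = 1\<close>.
  Three lines of \<open>L\<close> that meet pairwise are concurrent, since the conic has no three collinear
  points. So thinning out the intersection graph of the \<open>q + 1\<close> lines to a star at each covered
  point leaves a triangle-free graph, whose edges number \<open>q (q + 1)\<close> minus the size of the Kakeya set,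
  that is more than \<open>q\<^sup>2 / 4 + 1\<close>. Such a dense triangle-free graph is bipartite, and either part
  contains two vertices adjacent to the whole other part. These are two skew lines \<open>x\<close>, \<open>y\<close> and two skew
  lines \<open>u\<close>, \<open>v\<close> forming a quadrilateral. One quadric of the pencil through this quadrilateral contains
  the conic. Any further line of \<open>L\<close> has three points on it, namely its point at infinity and its
  intersections with \<open>x\<close> and \<open>y\<close>, or with \<open>u\<close> and \<open>v\<close>, and so lies on it as well.

  In even characteristic the nucleus yields both the number \<open>q + 1\<close> of points of the conic
  (every line of \<open>\<pi>\<close> through the nucleus is tangent) and the absence of three collinear ones.
\<close>

subsection \<open>Dense triangle-free graphs\<close>

definition nbrs :: "'v set \<Rightarrow> ('v \<Rightarrow> 'v \<Rightarrow> bool) \<Rightarrow> 'v \<Rightarrow> 'v set" where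
  "nbrs V E x = {y \<in> V. E x y}"

definition triangle_free :: "'v set \<Rightarrow> ('v \<Rightarrow> 'v \<Rightarrow> bool) \<Rightarrow> bool" where
  "triangle_free V E \<longleftrightarrow> (\<forall>x\<in>V. \<forall>y\<in>V. \<forall>z\<in>V. \<not> (E x y \<and> E y z \<and> E x z))"

definition independent_in :: "('v \<Rightarrow> 'v \<Rightarrow> bool) \<Rightarrow> 'v set \<Rightarrow> bool" where
  "independent_in E A \<longleftrightarrow> (\<forall>x\<in>A. \<forall>y\<in>A. \<not> E x y)"

text \<open>
  If every edge \<open>u v\<close> had \<open>d(u) + d(v) < q\<close>, summing over the edges would bound the sum of the squared
  degrees, against the Cauchy-Schwarz inequality.
\<close>

lemma heavy_edge:
  fixes V :: "'v set"
  assumes V: "finite V" "card V = q + 1" and sym: "\<And>x y. E x y \<Longrightarrow> E y x"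
    and many: "q^2 + 4 < 2 * (\<Sum>x\<in>V. card (nbrs V E x))"
  shows "\<exists>u\<in>V. \<exists>v\<in>V. E u v \<and> q \<le> card (nbrs V E u) + card (nbrs V E v)"
proof (rule ccontr)
  let ?d = "\<lambda>x. card (nbrs V E x)"
  let ?S = "\<Sum>x\<in>V. ?d x"
  assume "\<not> ?thesis"
  then have light: "?d u + ?d v < q" if "u \<in> V" "v \<in> V" "E u v" for u v
    using that by (meson not_less)
  have sq: "(\<Sum>x\<in>V. \<Sum>y\<in>nbrs V E x. ?d x) = (\<Sum>x\<in>V. (?d x)^2)"
    by (simp add: power2_eq_square)
  \<comment> \<open>Double counting: by symmetry \<open>?d y\<close> occurs once for each neighbour
    of \<open>y\<close>, so this sum too is the sum of the squared degrees.\<close>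
  have "(\<Sum>x\<in>V. \<Sum>y\<in>nbrs V E x. ?d y) = (\<Sum>x\<in>V. \<Sum>y\<in>V. if E x y then ?d y else 0)"
    by (simp only: sum.inter_filter[OF V(1), symmetric] nbrs_def)
  also have "\<dots> = (\<Sum>y\<in>V. \<Sum>x\<in>V. if E x y then ?d y else 0)"
    by (rule sum.swap)
  also have "\<dots> = (\<Sum>y\<in>V. \<Sum>x\<in>nbrs V E y. ?d y)"
  proof (rule sum.cong[OF refl])
    fix y assume "y \<in> V"
    have "{x \<in> V. E x y} = nbrs V E y"
      using sym by (auto simp: nbrs_def)
    then show "(\<Sum>x\<in>V. if E x y then ?d y else 0) = (\<Sum>x\<in>nbrs V E y. ?d y)"
      using V(1) by (simp add: sum.inter_filter[symmetric])
  qed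
  also have "\<dots> = (\<Sum>x\<in>V. (?d x)^2)" by (rule sq)
  finally have swap: "(\<Sum>x\<in>V. \<Sum>y\<in>nbrs V E x. ?d y) = (\<Sum>x\<in>V. (?d x)^2)" .
  have "2 * (\<Sum>x\<in>V. (?d x)^2) = (\<Sum>x\<in>V. \<Sum>y\<in>nbrs V E x. ?d x + ?d y)"
    using sq swap by (simp add: sum.distrib)
  \<comment> \<open>Truncation of \<open>q - 1\<close> is harmless: wherever an edge exists,
    \<open>light\<close> forces \<open>q > 0\<close>.\<close>
  also have "\<dots> \<le> (\<Sum>x\<in>V. \<Sum>y\<in>nbrs V E x. q - 1)"
    by (intro sum_mono) (use light in \<open>fastforce simp: nbrs_def\<close>)
  also have "\<dots> = ?S * (q - 1)"
    by (simp add: sum_distrib_right)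
  finally have upper: "2 * (\<Sum>x\<in>V. (?d x)^2) \<le> ?S * (q - 1)" .
  have "(\<Sum>x\<in>V. real (?d x))^2 \<le> (\<Sum>x\<in>V. (real (?d x))^2) * real (card V)"
    using sum_squared_le_sum_of_squares[of "\<lambda>x. real (?d x)" V] by (simp add: mult.commute)
  then have "real (?S^2) \<le> real ((\<Sum>x\<in>V. (?d x)^2) * (q + 1))"
    using V by (simp add: algebra_simps)
  then have "?S^2 \<le> (\<Sum>x\<in>V. (?d x)^2) * (q + 1)"
    by (simp only: of_nat_le_iff)
  then have "2 * ?S^2 \<le> 2 * (\<Sum>x\<in>V. (?d x)^2) * (q + 1)"
    by linarith
  also have "\<dots> \<le> ?S * (q - 1) * (q + 1)"
    using upper by (rule mult_right_mono) simp
  finally have "?S * (2 * ?S) \<le> ?S * ((q - 1) * (q + 1))"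
    by (simp add: power2_eq_square algebra_simps)
  moreover have "?S > 0" using many by linarith
  ultimately have "2 * ?S \<le> (q - 1) * (q + 1)" by simp
  also have "\<dots> \<le> q^2" by (cases q) (simp_all add: power2_eq_square)
  finally show False using many by linarith
qed

lemma four_mult_le_square: "4 * (a * b) \<le> (a + b)^2" for a b :: nat
proof -
  have "4 * (int a * int b) \<le> (int a + int b)^2"
    using zero_le_power2[of "int a - int b"] by (simp add: power2_eq_square algebra_simps)
  then have "int (4 * (a * b)) \<le> int ((a + b)^2)" by simp
  then show ?thesis by (simp only: of_nat_le_iff)
qed

text \<open>Edges appear as ordered pairs, so for symmetric \<open>E\<close> each edge is counted
  twice; the density bounds use this normalisation.\<close>

lemma degree_sum_eq_card:
  assumes "finite V"
  shows "(\<Sum>x\<in>V. card (nbrs V E x)) = card {(x, y). x \<in> V \<and> y \<in> V \<and> E x y}"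
proof -
  have "{(x, y). x \<in> V \<and> y \<in> V \<and> E x y} = Sigma V (nbrs V E)"
    by (auto simp: nbrs_def)
  then show ?thesis using assms by (simp add: nbrs_def)
qed

text \<open>
  The neighbourhoods of the two ends of a heavy edge are independent and miss at most one vertex
  \<open>w\<close>. If \<open>w\<close> had neighbours in both, the pairs of these would be non-edges, which costs too much.
\<close>

lemma dense_triangle_free_bipartite:
  fixes V :: "'v set"
  assumes V: "finite V" "card V = q + 1" and sym: "\<And>x y. E x y \<Longrightarrow> E y x"
    and tf: "triangle_free V E"
    and many: "q^2 + 4 < 2 * card {(x, y). x \<in> V \<and> y \<in> V \<and> E x y}"
  obtains A B where "A \<union> B = V" "A \<inter> B = {}" "independent_in E A" "independent_in E B"
proof -
  let ?N = "nbrs V E"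
  have "\<exists>u\<in>V. \<exists>v\<in>V. E u v \<and> q \<le> card (?N u) + card (?N v)"
    by (rule heavy_edge) (use V sym many degree_sum_eq_card[OF V(1)] in auto)
  then obtain u v where uv: "u \<in> V" "v \<in> V" "E u v" "q \<le> card (?N u) + card (?N v)"
    by blast
  define A where "A = ?N v"
  define B where "B = ?N u"
  have fin: "finite A" "finite B" using V(1) by (auto simp: A_def B_def nbrs_def)
  have sub: "A \<subseteq> V" "B \<subseteq> V" by (auto simp: A_def B_def nbrs_def)
  have disj: "A \<inter> B = {}"
    using tf uv sym unfolding triangle_free_def A_def B_def nbrs_def by blast
  have ind: "independent_in E A" "independent_in E B"
    using tf uv sym unfolding triangle_free_def A_def B_def nbrs_def independent_in_def by blast+
  have cAB: "card (A \<union> B) = card A + card B"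
    using fin disj by (rule card_Un_disjoint)
  have le: "card (A \<union> B) \<le> q + 1"
    using card_mono[of V "A \<union> B"] V sub by auto
  show thesis
  proof (cases "A \<union> B = V")
    case True
    then show ?thesis using that disj ind by blast
  next
    case False
    then have "A \<union> B \<subset> V" using sub by auto
    then have "card (A \<union> B) < q + 1" using psubset_card_mono V by metis
    \<comment> \<open>The heavy edge gives at least \<open>q\<close> and a missing vertex at most
      \<open>q\<close>, so exactly one vertex lies outside both neighbourhoods.\<close>
    then have cq: "card A + card B = q" using cAB uv(4) by (simp add: A_def B_def)
    have "card (V - (A \<union> B)) = 1"
      using V sub fin cAB cq by (simp add: card_Diff_subset)
    then obtain w where w: "V - (A \<union> B) = {w}" by (rule card_1_singletonE)
    then have wV: "w \<in> V" and wA: "w \<notin> A" and wB: "w \<notin> B" and Veq: "V = insert w (A \<union> B)"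
      using sub by auto
    have ww: "\<not> E w w" using tf wV unfolding triangle_free_def by blast
    define A' where "A' = {x \<in> A. E w x}"
    define B' where "B' = {x \<in> B. E w x}"
    have fin': "finite A'" "finite B'" using fin by (auto simp: A'_def B'_def)
    have none: "\<not> E x y" if "x \<in> A'" "y \<in> B'" for x y
      using that tf wV sub unfolding triangle_free_def A'_def B'_def by blast
    show ?thesis
    proof (cases "A' = {} \<or> B' = {}")
      case True
      then show ?thesis
      proof
        assume "A' = {}"
        then have "independent_in E (insert w A)"
          using ind(1) ww sym unfolding independent_in_def A'_def by blast
        then show ?thesis using that[of "insert w A" B] ind(2) wB disj Veq by auto
      next
        assume "B' = {}"
        then have "independent_in E (insert w B)"
          using ind(2) ww sym unfolding independent_in_def B'_def by blast
        then show ?thesis using that[of A "insert w B"] ind(1) wA disj Veq by auto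
      qed
    next
      case False
      then have pos: "card A' > 0" "card B' > 0" using fin' by (auto simp: card_gt_0_iff)
      define T where "T = A \<times> B - A' \<times> B'"
      have finT: "finite T" using fin by (simp add: T_def)
      have cT: "card T = card A * card B - card A' * card B'"
        unfolding T_def using fin' by (subst card_Diff_subset) (auto simp: A'_def B'_def card_cartesian_product)
      let ?P = "{(x, y). x \<in> V \<and> y \<in> V \<and> E x y}"
      \<comment> \<open>An edge at \<open>w\<close> ends in \<open>A'\<close> or \<open>B'\<close>.
        Any other edge joins \<open>A\<close> to \<open>B\<close>, and it avoids
        \<open>A' \<times> B'\<close>, where it would close a triangle with
        \<open>w\<close>.\<close>
      have "?P \<subseteq> T \<union> prod.swap ` T \<union> ({w} \<times> (A' \<union> B') \<union> (A' \<union> B') \<times> {w})"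
      proof
        fix z assume "z \<in> ?P"
        then obtain x y where z: "z = (x, y)" and xy: "x \<in> V" "y \<in> V" "E x y" by auto
        have "E y x" using sym xy by blast
        show "z \<in> T \<union> prod.swap ` T \<union> ({w} \<times> (A' \<union> B') \<union> (A' \<union> B') \<times> {w})"
        proof (cases "x = w \<or> y = w")
          case True
          then show ?thesis using z xy \<open>E y x\<close> ww Veq by (auto simp: A'_def B'_def)
        next
          case False
          then have "x \<in> A \<and> y \<in> B \<or> x \<in> B \<and> y \<in> A"
            using xy Veq ind unfolding independent_in_def by blast
          then show ?thesis
          proof
            assume "x \<in> A \<and> y \<in> B"
            then show ?thesis using z none xy by (auto simp: T_def)
          next
            assume "x \<in> B \<and> y \<in> A"
            then have "(y, x) \<in> T" using none \<open>E y x\<close> by (auto simp: T_def)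
            then have "prod.swap (y, x) \<in> prod.swap ` T" by (rule imageI)
            then show ?thesis using z by simp
          qed
        qed
      qed
      then have "card ?P \<le> card (T \<union> prod.swap ` T \<union> ({w} \<times> (A' \<union> B') \<union> (A' \<union> B') \<times> {w}))"
        using finT fin' by (intro card_mono) auto
      also have "\<dots> \<le> card (T \<union> prod.swap ` T) + card ({w} \<times> (A' \<union> B') \<union> (A' \<union> B') \<times> {w})"
        by (rule card_Un_le)
      also have "\<dots> \<le> card T + card (prod.swap ` T) + (card ({w} \<times> (A' \<union> B')) + card ((A' \<union> B') \<times> {w}))"
        by (intro add_mono card_Un_le)
      also have "\<dots> \<le> card T + card T + ((card A' + card B') + (card A' + card B'))"
        using card_image_le[OF finT, of prod.swap] card_Un_le[of A' B'] by (simp add: card_cartesian_product)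
      finally have cP: "card ?P \<le> 2 * card T + 2 * (card A' + card B')" by simp
      have "card A' * card B' \<le> card A * card B"
        using fin by (intro mult_mono card_mono) (auto simp: A'_def B'_def)
      \<comment> \<open>For positive sizes \<open>a\<close>, \<open>b\<close> this is
        \<open>(a - 1) * (b - 1) \<ge> 0\<close>: the edges at \<open>w\<close> exceed the lost
        pairs by at most one.\<close>
      moreover have "card A' + card B' \<le> card A' * card B' + 1"
      proof -
        from pos obtain i j where "card A' = Suc i" "card B' = Suc j" by (auto simp: gr0_conv_Suc)
        then show ?thesis by simp
      qed
      ultimately have "card T + (card A' + card B') \<le> card A * card B + 1"
        using cT by linarith
      moreover have "2 * card ?P \<le> 4 * (card T + (card A' + card B'))" using cP by simp
      ultimately have "2 * card ?P \<le> 4 * (card A * card B) + 4" by (simp add: algebra_simps)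
      also have "\<dots> \<le> q^2 + 4"
        using four_mult_le_square[of "card A" "card B"] cq by simp
      finally show ?thesis using many by linarith
    qed
  qed
qed

text \<open>A vertex of \<open>A\<close> that misses some vertex of \<open>B\<close> has at most
  \<open>card B - 1\<close> neighbours. Hence the edges number at most
  \<open>card A * (card B - 1)\<close> plus the number of full vertices. The product is at most a
  quarter of \<open>q^2\<close>, so more than one full vertex is needed to exceed that by more than
  1.\<close>

lemma dense_bipartite_full_vertices:
  fixes A B :: "'v set"
  assumes fin: "finite A" "finite B" and card: "card A + card B = q + 1"
    and sym: "\<And>x y. E x y \<Longrightarrow> E y x"
    and ind: "independent_in E A" "independent_in E B"
    and many: "q^2 + 4 < 2 * card {(x, y). x \<in> A \<union> B \<and> y \<in> A \<union> B \<and> E x y}"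
  obtains x y where "x \<in> A" "y \<in> A" "x \<noteq> y" "\<And>z. z \<in> B \<Longrightarrow> E x z \<and> E y z"
proof -
  let ?P = "{(x, y). x \<in> A \<union> B \<and> y \<in> A \<union> B \<and> E x y}"
  define T where "T = {(x, y). x \<in> A \<and> y \<in> B \<and> E x y}"
  have TS: "T = Sigma A (nbrs B E)" by (auto simp: T_def nbrs_def)
  have finT: "finite T" using fin by (auto simp: TS nbrs_def)
  have "?P \<subseteq> T \<union> prod.swap ` T"
  proof
    fix z assume "z \<in> ?P"
    then obtain x y where z: "z = (x, y)" and xy: "x \<in> A \<union> B" "y \<in> A \<union> B" "E x y" by auto
    have "E y x" using sym xy by blast
    then have "(x, y) \<in> T \<or> (y, x) \<in> T"
      using xy ind unfolding independent_in_def T_def by blast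
    then show "z \<in> T \<union> prod.swap ` T"
      using z imageI[of "(y, x)" T prod.swap] by auto
  qed
  then have "card ?P \<le> card (T \<union> prod.swap ` T)" using finT by (intro card_mono) auto
  also have "\<dots> \<le> card T + card (prod.swap ` T)" by (rule card_Un_le)
  also have "\<dots> \<le> 2 * card T" using card_image_le[OF finT, of prod.swap] by linarith
  finally have cP: "card ?P \<le> 2 * card T" .
  define F where "F = {x \<in> A. \<forall>z\<in>B. E x z}"
  have FA: "F \<subseteq> A" by (auto simp: F_def)
  have "card T = (\<Sum>x\<in>A. card (nbrs B E x))"
    unfolding TS using fin by (simp add: nbrs_def)
  also have "\<dots> \<le> (\<Sum>x\<in>A. card B - 1 + (if x \<in> F then 1 else 0))"
  proof (rule sum_mono)
    fix x assume x: "x \<in> A"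
    show "card (nbrs B E x) \<le> card B - 1 + (if x \<in> F then 1 else 0)"
    proof (cases "x \<in> F")
      case True
      have "card (nbrs B E x) \<le> card B" by (rule card_mono) (use fin in \<open>auto simp: nbrs_def\<close>)
      then show ?thesis using True by simp
    next
      case False
      then have "nbrs B E x \<subset> B" using x by (auto simp: nbrs_def F_def)
      then have "card (nbrs B E x) < card B" using fin psubset_card_mono by blast
      then show ?thesis using False by simp
    qed
  qed
  also have "\<dots> = card A * (card B - 1) + card F"
    using fin FA by (simp add: sum.distrib sum.If_cases Int_absorb1)
  finally have cT: "card T \<le> card A * (card B - 1) + card F" .
  have "4 * (card A * (card B - 1)) \<le> q^2"
  \<comment> \<open>For nonempty \<open>B\<close> the two factors add up to \<open>q\<close>. The
    empty case is separate because \<open>card B - 1\<close> is truncated.\<close>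
  proof (cases "card B")
    case 0
    then show ?thesis by simp
  next
    case (Suc k)
    then show ?thesis using four_mult_le_square[of "card A" k] card by simp
  qed
  then have "4 * card T \<le> q^2 + 4 * card F" using cT by linarith
  then have "2 \<le> card F" using cP many by linarith
  then obtain F2 where "F2 \<subseteq> F" "card F2 = 2" by (meson obtain_subset_with_card_n)
  then obtain x y where "x \<in> F" "y \<in> F" "x \<noteq> y" by (auto simp: card_2_iff)
  then show thesis using that by (auto simp: F_def)
qed

subsection \<open>Subspaces over a finite field\<close>

text \<open>Every element of the larger span is uniquely \<open>k *s a + x\<close> with
  \<open>x\<close> in the smaller one, so each new basis vector multiplies the size by the order of
  the field.\<close>

lemma card_span_independent:
  fixes B :: "('a::{field,finite} ^ 'n) set"
  assumes "vec.independent B"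
  shows "card (vec.span B) = CARD('a) ^ card B"
proof -
  have "finite B" using assms by (rule vec.finiteI_independent)
  then show ?thesis using assms
  proof (induction B)
    case empty
    then show ?case by simp
  next
    case (insert a B)
    then have B: "vec.independent B" and a: "a \<notin> vec.span B"
      by (auto simp: vec.independent_insert)
    let ?f = "\<lambda>(k, x). k *s a + x"
    have "inj_on ?f (UNIV \<times> vec.span B)"
    proof (rule inj_onI, clarify)
      fix k x l y assume x: "x \<in> vec.span B" and y: "y \<in> vec.span B"
        and eq: "k *s a + x = l *s a + y"
      have "(k - l) *s a = y - x" using eq by (simp add: algebra_simps)
      then have m: "(k - l) *s a \<in> vec.span B" using x y by (simp add: vec.span_diff)
      have "k = l"
      proof (rule ccontr)
        assume "k \<noteq> l"
        then have "a = inverse (k - l) *s ((k - l) *s a)" by simp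
        then show False using a m vec.span_scale by metis
      qed
      then show "k = l \<and> x = y" using eq by simp
    qed
    moreover have "?f ` (UNIV \<times> vec.span B) = vec.span (insert a B)"
    proof (intro set_eqI iffI)
      fix x assume "x \<in> ?f ` (UNIV \<times> vec.span B)"
      then obtain k y where "y \<in> vec.span B" "x = k *s a + y" by auto
      then have "x - k *s a \<in> vec.span B" by simp
      then show "x \<in> vec.span (insert a B)" using vec.span_breakdown_eq by blast
    next
      fix x assume "x \<in> vec.span (insert a B)"
      then obtain k where "x - k *s a \<in> vec.span B" by (auto simp: vec.span_insert)
      then show "x \<in> ?f ` (UNIV \<times> vec.span B)"
        by (intro image_eqI[of _ _ "(k, x - k *s a)"]) auto
    qed
    ultimately have "card (vec.span (insert a B)) = card (UNIV \<times> vec.span B :: ('a \<times> _) set)"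
      using card_image by metis
    then show ?case using insert B by (simp add: card_cartesian_product)
  qed
qed

lemma card_subspace:
  fixes S :: "('a::{field,finite} ^ 'n) set"
  assumes "vec.subspace S"
  shows "card S = CARD('a) ^ vec.dim S"
proof -
  obtain B where B: "B \<subseteq> S" "vec.independent B" "S \<subseteq> vec.span B" "card B = vec.dim S"
    using vec.basis_exists by blast
  then have "vec.span B = S" using assms by (simp add: vec.span_subspace)
  then show ?thesis using card_span_independent[OF B(2)] B(4) by simp
qed

lemma point_eq_span:
  assumes "P \<in> pg_points" "v \<in> P" "v \<noteq> 0"
  shows "P = vec.span {v}"
  using assms vec.subspace_dim_equal[of "vec.span {v}" P]
  by (simp add: pg_points_def vec.span_minimal)

lemma dim_span_pair:
  assumes "a \<noteq> 0" "\<And>k. b \<noteq> k *s a"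
  shows "vec.dim (vec.span {a, b}) = 2"
proof -
  have "b \<notin> vec.span {a}" using assms(2) by (auto simp: vec.span_singleton)
  then have "vec.independent {b, a}" "b \<noteq> a"
    using assms(1) vec.span_base[of a "{a}"] by (auto simp: vec.independent_insert)
  then show ?thesis
    using vec.dim_span_eq_card_independent[of "{b, a}"] by (simp add: insert_commute)
qed

lemma span_pair: "vec.span {a, b} = {i *s a + j *s b | i j. True}"
proof (intro set_eqI iffI)
  fix x assume "x \<in> vec.span {a, b}"
  then obtain i where "x - i *s a \<in> vec.span {b}" using vec.span_breakdown_eq by blast
  then obtain j where "x - i *s a = j *s b" by (auto simp: vec.span_singleton)
  then have "x = i *s a + j *s b" by (simp add: algebra_simps)
  then show "x \<in> {i *s a + j *s b | i j. True}" by blast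
next
  fix x assume "x \<in> {i *s a + j *s b | i j. True}"
  then show "x \<in> vec.span {a, b}"
    by (blast intro: vec.span_add vec.span_scale vec.span_base)
qed

lemma span_pairD:
  assumes "vec.subspace S" "vec.dim S = 2" "a \<in> S" "b \<in> S" "a \<noteq> 0" "\<And>k. b \<noteq> k *s a" "x \<in> S"
  obtains i j where "x = i *s a + j *s b"
proof -
  have "b \<notin> vec.span {a}" using assms(6) by (auto simp: vec.span_singleton)
  then have "vec.independent {b, a}" "b \<noteq> a"
    using assms(5) vec.span_base[of a "{a}"] by (auto simp: vec.independent_insert)
  then have "S \<subseteq> vec.span {b, a}"
    using assms by (intro vec.card_ge_dim_independent) auto
  then obtain j where "x - j *s b \<in> vec.span {a}"
    using assms(7) vec.span_breakdown_eq by blast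
  then obtain i where "x - j *s b = i *s a" by (auto simp: vec.span_singleton)
  then have "x = i *s a + j *s b" by (simp add: algebra_simps)
  then show thesis by (rule that)
qed

lemma span_tripleD:
  assumes "vec.subspace S" "vec.dim S = 3" "a \<in> S" "b \<in> S" "c \<in> S"
    "a \<noteq> 0" "\<And>k. b \<noteq> k *s a" "\<And>i j. c \<noteq> i *s a + j *s b" "x \<in> S"
  obtains i j k where "x = i *s a + j *s b + k *s c"
proof -
  have b: "b \<notin> vec.span {a}" using assms(7) by (auto simp: vec.span_singleton)
  have c: "c \<notin> vec.span {b, a}"
  proof
    assume "c \<in> vec.span {b, a}"
    then obtain j where "c - j *s b \<in> vec.span {a}" using vec.span_breakdown_eq by blast
    then obtain i where "c - j *s b = i *s a" by (auto simp: vec.span_singleton)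
    then have "c = i *s a + j *s b" by (simp add: algebra_simps)
    then show False using assms(8) by blast
  qed
  have "vec.independent {c, b, a}" "b \<noteq> a" "c \<noteq> a" "c \<noteq> b"
    using b c assms(6) vec.span_base[of a "{a}"] vec.span_base[of b "{b, a}"]
      vec.span_base[of a "{b, a}"] by (auto simp: vec.independent_insert)
  then have "S \<subseteq> vec.span {c, b, a}"
    using assms by (intro vec.card_ge_dim_independent) auto
  then obtain k where "x - k *s c \<in> vec.span {b, a}"
    using assms(9) vec.span_breakdown_eq by blast
  then obtain j where "x - k *s c - j *s b \<in> vec.span {a}"
    using vec.span_breakdown_eq by blast
  then obtain i where "x - k *s c - j *s b = i *s a" by (auto simp: vec.span_singleton)
  then have "x = i *s a + j *s b + k *s c" by (simp add: algebra_simps)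
  then show thesis by (rule that)
qed

text \<open>Fix \<open>p\<close> outside the plane; the value of \<open>w\<close> at
  \<open>x\<close> is the coefficient of \<open>p\<close> in \<open>x\<close> modulo the plane. This
  form gives affine points a normalised vector.\<close>

lemma plane_functional:
  fixes \<pi> :: "('a::field ^ 4) set"
  assumes plane: "vec.subspace \<pi>" "vec.dim \<pi> = 3"
  shows "\<exists>w :: 'a ^ 4 \<Rightarrow> 'a. (\<forall>a b. w (a + b) = w a + w b) \<and> (\<forall>c a. w (c *s a) = c * w a)
    \<and> (\<forall>x. x \<in> \<pi> \<longleftrightarrow> w x = 0)"
proof -
  have span: "vec.span \<pi> = \<pi>" using plane by simp
  have dim4: "vec.dim (UNIV :: ('a ^ 4) set) = 4" by (simp add: card_cart_basis)
  then have "\<pi> \<noteq> UNIV" using plane(2) by auto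
  then obtain p where p: "p \<notin> \<pi>" by blast
  have "vec.dim (insert p \<pi>) = vec.dim (UNIV :: ('a ^ 4) set)"
    using p plane(2) vec.dim_insert[of p \<pi>] unfolding span dim4 by simp
  then have full: "vec.span (insert p \<pi>) = UNIV"
    using vec.dim_eq_span[of "insert p \<pi>" UNIV] by simp
  have ex: "\<exists>c. x - c *s p \<in> \<pi>" for x
    using full vec.span_breakdown_eq[of x p \<pi>] span by auto
  have uniq: "c = d" if "x - c *s p \<in> \<pi>" "x - d *s p \<in> \<pi>" for x c d
  proof (rule ccontr)
    assume "c \<noteq> d"
    have "(x - c *s p) - (x - d *s p) = (d - c) *s p" by (simp add: algebra_simps)
    then have "(d - c) *s p \<in> \<pi>" using vec.subspace_diff[OF plane(1) that] by simp
    then have "inverse (d - c) *s ((d - c) *s p) \<in> \<pi>" by (rule vec.subspace_scale[OF plane(1)])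
    then show False using \<open>c \<noteq> d\<close> p by simp
  qed
  define w where "w x = (THE c. x - c *s p \<in> \<pi>)" for x
  have w: "w x = c" if "x - c *s p \<in> \<pi>" for x c
    unfolding w_def using that uniq by (intro the_equality) auto
  have w': "x - w x *s p \<in> \<pi>" for x using ex w by metis
  show ?thesis
  proof (intro exI[of _ w] conjI allI)
    show "w (a + b) = w a + w b" for a b
    proof (rule w)
      have "a + b - (w a + w b) *s p = (a - w a *s p) + (b - w b *s p)" by (simp add: algebra_simps)
      then show "a + b - (w a + w b) *s p \<in> \<pi>" using vec.subspace_add[OF plane(1) w' w'] by metis
    qed
    show "w (c *s a) = c * w a" for c a
    proof (rule w)
      have "c *s a - (c * w a) *s p = c *s (a - w a *s p)" by (simp add: algebra_simps)
      then show "c *s a - (c * w a) *s p \<in> \<pi>" using vec.subspace_scale[OF plane(1) w'] by metis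
    qed
    show "x \<in> \<pi> \<longleftrightarrow> w x = 0" for x
      using w[of x 0] w'[of x] by auto
  qed
qed

subsection \<open>Quadratic forms\<close>

definition polar :: "('a::field ^ 'n \<Rightarrow> 'a) \<Rightarrow> 'a ^ 'n \<Rightarrow> 'a ^ 'n \<Rightarrow> 'a" where
  "polar F v w = F (v + w) - F v - F w"

text \<open>Coordinate-free properties of a quadratic form: they survive composition with a matrix
  without tracking coefficients.\<close>

locale quadratic_map =
  fixes F :: "'a::field ^ 'n \<Rightarrow> 'a"
  assumes scale: "F (c *s v) = c\<^sup>2 * F v"
    and polar_add: "polar F (u + v) w = polar F u w + polar F v w"
    and polar_scale: "polar F (c *s u) v = c * polar F u v"
begin

lemma zero [simp]: "F 0 = 0"
  using scale[of 0 0] by simp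

lemma add: "F (v + w) = F v + F w + polar F v w"
  by (simp add: polar_def)

lemma polar_sym: "polar F v w = polar F w v"
  by (simp add: polar_def add.commute)

lemma polar_add_right: "polar F w (u + v) = polar F w u + polar F w v"
  using polar_add polar_sym by metis

lemma polar_scale_right: "polar F v (c *s u) = c * polar F v u"
  using polar_scale polar_sym by metis

lemma uminus: "F (- v) = F v"
  using scale[of "-1" v] by simp

lemma polar_uminus_right: "polar F v (- w) = - polar F v w"
  using polar_scale_right[of v "-1" w] by simp

lemma diff: "F (v - w) = F v + F w - polar F v w"
  using add[of v "- w"] by (simp add: uminus polar_uminus_right)

lemma polar_self: "polar F v v = 2 * F v"
proof -
  have "F (v + v) = 4 * F v"
    using scale[of 2 v] by (simp add: vec.scale_left_distrib[of 1 1, simplified])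
  then show ?thesis by (simp add: polar_def algebra_simps)
qed

lemma lincomb: "F (i *s a + j *s b) = i\<^sup>2 * F a + j\<^sup>2 * F b + i * j * polar F a b"
  by (simp add: add scale polar_scale polar_scale_right algebra_simps)

end

lemma quadratic_map_of_form:
  assumes "quadratic_form F"
  shows "quadratic_map F"
proof -
  obtain c where F: "\<And>x. F x = (\<Sum>i\<in>UNIV. \<Sum>j\<in>UNIV. c $ i $ j * x $ i * x $ j)"
    using assms by (auto simp: quadratic_form_def)
  have P: "polar F v w = (\<Sum>i\<in>UNIV. \<Sum>j\<in>UNIV. c $ i $ j * (v $ i * w $ j + w $ i * v $ j))" for v w
    unfolding polar_def F by (simp add: sum_subtractf[symmetric] algebra_simps)
  show ?thesis
  proof
    show "F (k *s v) = k\<^sup>2 * F v" for k v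
      by (simp add: F sum_distrib_left power2_eq_square mult_ac)
    show "polar F (u + v) w = polar F u w + polar F v w" for u v w
      by (simp add: P sum.distrib[symmetric] algebra_simps)
    show "polar F (k *s u) v = k * polar F u v" for k u v
      by (simp add: P sum_distrib_left algebra_simps)
  qed
qed

subsection \<open>Conics in even characteristic\<close>

text \<open>If some double were nonzero, negation would pair off the nonzero elements without fixed
  points, and the order of the field would be odd.\<close>

lemma double_eq_0_of_even_card:
  fixes x :: "'a::{field,finite}"
  assumes "even CARD('a)"
  shows "x + x = 0"
proof (rule ccontr)
  assume nz: "x + x \<noteq> 0"
  have neg: "- y \<noteq> y" if "y \<noteq> 0" for y :: 'a
  proof
    assume "- y = y"
    then have "(1 + 1) * y = 0" by (simp add: distrib_right eq_neg_iff_add_eq_0)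
    then have "(1 + 1 :: 'a) = 0" using that by simp
    then have "(1 + 1) * x = 0" by simp
    then show False using nz by (simp add: distrib_right)
  qed
  let ?U = "UNIV - {0 :: 'a}"
  have even: "even n" if "of_nat n = (0 :: 2)" for n
    using that by (simp add: of_nat_eq_0_iff_char_dvd)
  \<comment> \<open>Paired summands cancel because \<open>1 + 1 = 0\<close> in the type
    \<open>2\<close>; a vanishing sum there means an even number of summands.\<close>
  have "(\<Sum>y\<in>?U. 1 :: 2) = 0"
    by (rule sum_involution_eq_0[where h = uminus]) (use neg in auto)
  then have "of_nat (card ?U) = (0 :: 2)" by (simp only: sum_constant mult_1_right)
  then have "even (card ?U)" by (rule even)
  moreover have "Suc (card ?U) = CARD('a)" by (rule card_Suc_Diff1) simp_all
  ultimately show False using assms by (metis even_Suc)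
qed

text \<open>In characteristic 2 the polar form is alternating, and an alternating form on a space of
  odd dimension has a nonzero radical. For a non-singular conic the radical is the nucleus.\<close>

lemma nucleus_exists:
  fixes \<pi> :: "('a::field ^ 'n) set"
  assumes "quadratic_map F" and char2: "\<And>x :: 'a. x + x = 0"
    and plane: "vec.subspace \<pi>" "vec.dim \<pi> = 3"
  obtains N where "N \<in> \<pi>" "N \<noteq> 0" "\<And>v. v \<in> \<pi> \<Longrightarrow> polar F N v = 0"
proof -
  interpret quadratic_map F by fact
  have alt: "polar F v v = 0" for v by (simp add: polar_self mult_2 char2)
  obtain B where B: "B \<subseteq> \<pi>" "vec.independent B" "\<pi> \<subseteq> vec.span B" "card B = 3"
    using vec.basis_exists[of \<pi>] plane by metis
  from \<open>card B = 3\<close> obtain a b c where Beq: "B = {a, b, c}" and ne: "a \<noteq> b" "b \<noteq> c" "a \<noteq> c"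
    by (auto simp: card_3_iff)
  have mem: "a \<in> \<pi>" "b \<in> \<pi>" "c \<in> \<pi>" using B Beq by auto
  have coords: "i = 0 \<and> j = 0 \<and> k = 0" if "i *s a + j *s b + k *s c = 0" for i j k
  proof -
    let ?u = "\<lambda>v. if v = a then i else if v = b then j else k"
    have z: "(\<Sum>v\<in>B. ?u v *s v) = 0" using that ne by (simp add: Beq add.assoc)
    have "?u v = 0" if "v \<in> B" for v
      using vec.independentD[OF B(2), of B ?u v] z that by (auto simp: Beq)
    from this[of a] this[of b] this[of c] show ?thesis using ne by (auto simp: Beq split: if_splits)
  qed
  have gen: "\<exists>i j k. v = i *s a + j *s b + k *s c" if "v \<in> \<pi>" for v
  proof -
    from that B Beq have "v \<in> vec.span {a, b, c}" by auto
    then obtain i where "v - i *s a \<in> vec.span {b, c}" using vec.span_breakdown_eq by blast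
    then obtain j where "v - i *s a - j *s b \<in> vec.span {c}" using vec.span_breakdown_eq by blast
    then obtain k where "v - i *s a - j *s b = k *s c" by (auto simp: vec.span_singleton)
    then have "v = i *s a + j *s b + k *s c" by (simp add: algebra_simps)
    then show ?thesis by blast
  qed
  \<comment> \<open>In \<open>polar F N a\<close> the two surviving products coincide, hence cancel
    in characteristic 2; likewise for \<open>b\<close> and \<open>c\<close>.\<close>
  define N where "N = polar F b c *s a + polar F a c *s b + polar F a b *s c"
  have N: "N \<in> \<pi>" unfolding N_def using mem plane(1) by (intro vec.subspace_add vec.subspace_scale)
  have Nabc: "polar F N a = 0" "polar F N b = 0" "polar F N c = 0"
    unfolding N_def by (simp_all add: polar_add polar_scale alt polar_sym[of b a] polar_sym[of c a]
        polar_sym[of c b] mult.commute char2)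
  have Nrad: "polar F N v = 0" if "v \<in> \<pi>" for v
    using gen[OF that] Nabc by (auto simp: polar_add_right polar_scale_right)
  show thesis
  proof (cases "N = 0")
    case False
    then show ?thesis using N Nrad that by blast
  next
    \<comment> \<open>All polar values of basis vectors vanish, so the polar form is zero on
      \<open>\<pi>\<close> and any nonzero vector serves.\<close>
    case True
    then have p0: "polar F b c = 0" "polar F a c = 0" "polar F a b = 0"
      using coords[of "polar F b c" "polar F a c" "polar F a b"] by (auto simp: N_def)
    have "polar F a v = 0" if "v \<in> \<pi>" for v
      using gen[OF that] p0 by (auto simp: polar_add_right polar_scale_right alt)
    moreover have "a \<noteq> 0" using coords[of 1 0 0] by auto
    ultimately show ?thesis using mem that by blast
  qed
qed

lemma square_surj_of_char2:
  fixes x :: "'a::{field,finite}"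
  assumes char2: "\<And>x :: 'a. x + x = 0"
  obtains y where "y\<^sup>2 = x"
proof -
  have "inj (\<lambda>y :: 'a. y\<^sup>2)"
  proof (rule injI)
    fix y z :: 'a assume "y\<^sup>2 = z\<^sup>2"
    then have "y = z \<or> y = - z" by (simp add: power2_eq_iff)
    moreover have "- z = z" using char2[of z] by (simp add: add_eq_0_iff)
    ultimately show "y = z" by auto
  qed
  then have "surj (\<lambda>y :: 'a. y\<^sup>2)" by (simp add: finite_UNIV_inj_surj)
  then show thesis using that by (metis surjD)
qed

text \<open>If \<open>d\<close> and \<open>d'\<close> were independent, \<open>F\<close> would
  vanish on their span, which therefore misses the nucleus \<open>N\<close>. So \<open>d\<close>,
  \<open>d'\<close>, \<open>N\<close> span \<open>\<pi>\<close>, and \<open>d\<close> is orthogonal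
  to all three, hence singular. This excludes three collinear points on the conic.\<close>

lemma polar_nonzero_on_conic:
  fixes \<pi> :: "('a::field ^ 4) set"
  assumes "quadratic_map F" and char2: "\<And>x :: 'a. x + x = 0"
    and plane: "vec.subspace \<pi>" "vec.dim \<pi> = 3" and ns: "nonsingular_on \<pi> F"
    and d: "d \<in> \<pi>" "d' \<in> \<pi>" "F d = 0" "F d' = 0" "polar F d d' = 0" "d \<noteq> 0"
  shows "\<exists>k. d' = k *s d"
proof (rule ccontr)
  assume ind: "\<nexists>k. d' = k *s d"
  interpret quadratic_map F by fact
  obtain N where N: "N \<in> \<pi>" "N \<noteq> 0" "\<And>v. v \<in> \<pi> \<Longrightarrow> polar F N v = 0"
    using nucleus_exists[OF assms(1) char2 plane] by blast
  have "F N \<noteq> 0" using ns N unfolding nonsingular_on_def polar_def[symmetric] by blast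
  then have "N \<noteq> i *s d + j *s d'" for i j
    using d by (auto simp: lincomb)
  then have "polar F d v = 0" if "v \<in> \<pi>" for v
    using span_tripleD[OF plane d(1,2) N(1) d(6) _ _ that] ind N(3)[OF d(1)] d
    by (metis polar_add_right polar_scale_right polar_self char2 add_0 polar_sym)
  then show False using ns d unfolding nonsingular_on_def polar_def[symmetric] by blast
qed

text \<open>Each vector of the plane is uniquely a zero of \<open>F\<close> plus a multiple of the
  nucleus, because \<open>F (v + k *s N) = F v + k\<^sup>2 * F N\<close> and square roots are
  unique. So \<open>F\<close> has \<open>q\<^sup>2\<close> zeros, and each point of the conic
  accounts for \<open>q - 1\<close> of the nonzero ones.\<close>

lemma card_nonsingular_conic:
  fixes \<pi> :: "('a::{field,finite} ^ 4) set"
  assumes "quadratic_map F" and char2: "\<And>x :: 'a. x + x = 0"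
    and plane: "vec.subspace \<pi>" "vec.dim \<pi> = 3" and ns: "nonsingular_on \<pi> F"
  shows "card {P \<in> zero_points F. P \<subseteq> \<pi>} = CARD('a) + 1"
proof -
  interpret quadratic_map F by fact
  let ?C = "{P \<in> zero_points F. P \<subseteq> \<pi>}" and ?q = "CARD('a)"
  obtain N where N: "N \<in> \<pi>" "N \<noteq> 0" "\<And>v. v \<in> \<pi> \<Longrightarrow> polar F N v = 0"
    using nucleus_exists[OF assms(1) char2 plane] by blast
  have FN: "F N \<noteq> 0" using ns N unfolding nonsingular_on_def polar_def[symmetric] by blast
  define Z where "Z = {v \<in> \<pi>. F v = 0}"
  have addN: "F (v + k *s N) = F v + k\<^sup>2 * F N" if "v \<in> \<pi>" for v k
    using N(3)[OF that] by (simp add: add scale polar_scale_right polar_sym[of v N])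
  let ?f = "\<lambda>(v, k). v + k *s N"
  have "inj_on ?f (Z \<times> UNIV)"
  proof (rule inj_onI, clarify)
    fix v k v' k' assume v: "v \<in> Z" "v' \<in> Z" and eq: "v + k *s N = v' + k' *s N"
    have "v' = v + (k - k') *s N" using eq by (simp add: algebra_simps)
    then have "(k - k')\<^sup>2 * F N = 0" using addN[of v "k - k'"] v by (simp add: Z_def)
    then have "k = k'" using FN by simp
    then show "v = v' \<and> k = k'" using eq by simp
  qed
  moreover have "?f ` (Z \<times> UNIV) = \<pi>"
  proof (intro set_eqI iffI)
    fix x assume "x \<in> ?f ` (Z \<times> UNIV)"
    then show "x \<in> \<pi>" using N(1) plane(1) by (auto simp: Z_def intro!: vec.subspace_add vec.subspace_scale)
  next
    fix x assume x: "x \<in> \<pi>"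
    \<comment> \<open>Then \<open>k\<^sup>2 * F N\<close> equals \<open>F x\<close>, and the two
      copies cancel in characteristic 2.\<close>
    obtain k where k: "k\<^sup>2 = F x / F N" using square_surj_of_char2[OF char2] by blast
    have "F (x + k *s N) = 0" using addN[OF x] k FN char2 by simp
    then have "x + k *s N \<in> Z"
      using x N(1) plane(1) by (simp add: Z_def vec.subspace_add vec.subspace_scale)
    then show "x \<in> ?f ` (Z \<times> UNIV)"
      by (intro image_eqI[of _ _ "(x + k *s N, - k)"]) auto
  qed
  ultimately have "card (Z \<times> (UNIV :: 'a set)) = card \<pi>" using card_image by metis
  then have "card Z * ?q = ?q ^ 3" using card_subspace[OF plane(1)] plane(2) by (simp add: card_cartesian_product)
  then have cZ: "card Z = ?q\<^sup>2" by (simp add: power3_eq_cube power2_eq_square)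
  have pt: "vec.subspace P" "card P = ?q" "P \<subseteq> Z" if "P \<in> ?C" for P
    using that card_subspace[of P] by (auto simp: zero_points_def pg_points_def Z_def)
  have "Z - {0} = (\<Union>P\<in>?C. P - {0})"
  proof (intro set_eqI iffI)
    fix v assume v: "v \<in> Z - {0}"
    then have "vec.span {v} \<subseteq> \<pi>" using plane(1) by (simp add: vec.span_minimal Z_def)
    moreover have "F x = 0" if "x \<in> vec.span {v}" for x
      using that v by (auto simp: vec.span_singleton scale Z_def)
    ultimately have "vec.span {v} \<in> ?C" using v by (simp add: zero_points_def pg_points_def)
    then show "v \<in> (\<Union>P\<in>?C. P - {0})" using v vec.span_base[of v "{v}"] by blast
  next
    fix v assume "v \<in> (\<Union>P\<in>?C. P - {0})"
    then show "v \<in> Z - {0}" using pt(3) by blast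
  qed
  also have "card \<dots> = (\<Sum>P\<in>?C. card (P - {0}))"
  proof (rule card_UN_disjoint)
    show "\<forall>P\<in>?C. \<forall>P'\<in>?C. P \<noteq> P' \<longrightarrow> (P - {0}) \<inter> (P' - {0}) = {}"
    proof (intro ballI impI)
      fix P P' assume P: "P \<in> ?C" "P' \<in> ?C" "P \<noteq> P'"
      have "vec.span {v} = R" if "R \<in> ?C" "v \<in> R" "v \<noteq> 0" for R v
        using that vec.subspace_dim_equal[of "vec.span {v}" R]
        by (simp add: zero_points_def pg_points_def vec.span_minimal)
      then show "(P - {0}) \<inter> (P' - {0}) = {}" using P by blast
    qed
  qed simp_all
  also have "\<dots> = (\<Sum>P\<in>?C. ?q - 1)"
  proof (rule sum.cong[OF refl])
    fix P assume "P \<in> ?C"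
    then show "card (P - {0}) = ?q - 1"
      using pt(2) vec.subspace_0[OF pt(1)] by (simp add: card_Diff_singleton)
  qed
  also have "\<dots> = card ?C * (?q - 1)" by simp
  finally have "card Z - 1 = card ?C * (?q - 1)"
    by (simp add: card_Diff_singleton Z_def vec.subspace_0[OF plane(1)])
  moreover have "?q\<^sup>2 - 1 = (?q + 1) * (?q - 1)"
    by (simp add: power2_eq_square algebra_simps)
  moreover have "?q - 1 > 0"
  proof -
    have "card {0, 1 :: 'a} \<le> ?q" by (rule card_mono) auto
    then show ?thesis by simp
  qed
  ultimately have "card ?C * (?q - 1) = (?q + 1) * (?q - 1)" "?q - 1 \<noteq> 0" using cZ by simp_all
  then show ?thesis by (simp only: mult_cancel2) simp
qed

subsection \<open>The intersection graph of a Kakeya line set\<close>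

text \<open>The Kakeya line set in terms of vectors: \<open>w a = 1\<close> normalises affine points
  and \<open>w d = 0\<close> marks directions. A direction is a whole one-dimensional subspace, so
  it has \<open>CARD('a)\<close> vectors including 0. The number of lines is that of the points of
  the conic.\<close>

locale conic_lines = quadratic_map F for F :: "'a::{field,finite} ^ 4 \<Rightarrow> 'a" +
  fixes w :: "'a ^ 4 \<Rightarrow> 'a" and L :: "('a ^ 4) set set"
  assumes w_add: "w (a + b) = w a + w b" and w_scale: "w (c *s a) = c * w a"
    and polar_nonzero: "\<lbrakk>w d = 0; w d' = 0; F d = 0; F d' = 0; polar F d d' = 0; d \<noteq> 0\<rbrakk>
      \<Longrightarrow> \<exists>k. d' = k *s d"
    and line: "l \<in> L \<Longrightarrow> vec.subspace l" "l \<in> L \<Longrightarrow> vec.dim l = 2"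
    and affine: "l \<in> L \<Longrightarrow> \<exists>a\<in>l. w a = 1"
    and direction: "\<lbrakk>l \<in> L; d \<in> l; w d = 0\<rbrakk> \<Longrightarrow> F d = 0"
    and card_direction: "l \<in> L \<Longrightarrow> card {d \<in> l. w d = 0} = CARD('a)"
    and direction_unique: "\<lbrakk>l \<in> L; m \<in> L; l \<noteq> m; d \<in> l; d \<in> m; w d = 0\<rbrakk> \<Longrightarrow> d = 0"
    and card_L: "card L = CARD('a) + 1"
begin

lemma w_diff: "w (a - b) = w a - w b"
  using w_add[of "a - b" b] by simp

lemma line_diff: "l \<in> L \<Longrightarrow> a \<in> l \<Longrightarrow> b \<in> l \<Longrightarrow> a - b \<in> l"
  using line(1) vec.subspace_diff by blast

lemma meet_unique:
  assumes "l \<in> L" "m \<in> L" "l \<noteq> m" "a \<in> l" "a \<in> m" "b \<in> l" "b \<in> m" "w a = 1" "w b = 1"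
  shows "a = b"
  using direction_unique[of l m "a - b"] assms by (simp add: line_diff w_diff)

text \<open>The directions of the sides of a triangle would be three collinear points of the conic.\<close>

lemma triangle_concurrent:
  assumes L: "l \<in> L" "m \<in> L" "k \<in> L" and ne: "l \<noteq> m" "l \<noteq> k" "m \<noteq> k"
    and a: "a \<in> l" "a \<in> m" "w a = 1" and b: "b \<in> l" "b \<in> k" "w b = 1"
    and c: "c \<in> m" "c \<in> k" "w c = 1"
  shows "a = b"
proof (rule ccontr)
  assume ab: "a \<noteq> b"
  have ac: "a \<noteq> c"
    using meet_unique[OF L(1,3) ne(2)] a b c ab by blast
  have F: "F (a - b) = 0" "F (a - c) = 0" "F (c - b) = 0"
    using direction[OF L(1), of "a - b"] direction[OF L(2), of "a - c"] direction[OF L(3), of "c - b"]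
      L a b c by (simp_all add: line_diff w_diff)
  \<comment> \<open>\<open>F\<close> vanishes at two sides of the triangle and at their difference,
    the third side, so the polar value of the two is 0.\<close>
  moreover have "(a - b) - (a - c) = c - b" by simp
  ultimately have "polar F (a - b) (a - c) = 0" using diff[of "a - b" "a - c"] by simp
  then obtain k where k: "a - c = k *s (a - b)"
    using polar_nonzero[of "a - b" "a - c"] F a b c ab by (auto simp: w_diff)
  \<comment> \<open>Parallel sides would give the distinct lines \<open>l\<close> and
    \<open>m\<close> the same point at infinity.\<close>
  then have "a - c \<in> l" using line(1)[OF L(1)] line_diff[OF L(1)] a b by (simp add: vec.subspace_scale)
  then have "a - c = 0"
    using direction_unique[OF L(1,2) ne(1), of "a - c"] line_diff[OF L(2)] a c by (simp add: w_diff)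
  then show False using ac by simp
qed

definition pts :: "('a ^ 4) set" where
  "pts = {a. w a = 1 \<and> (\<exists>l\<in>L. a \<in> l)}"

text \<open>
  The lines through a covered point \<open>a\<close> form a clique of intersecting lines. Keeping only the star
  around a chosen line \<open>centre a\<close> turns the intersection graph into a triangle-free graph whose
  number of edges is exactly the overlap \<open>q (q + 1) - card pts\<close>.
\<close>

definition centre :: "'a ^ 4 \<Rightarrow> ('a ^ 4) set" where
  "centre a = (SOME l. l \<in> L \<and> a \<in> l)"

definition edge :: "('a ^ 4) set \<Rightarrow> ('a ^ 4) set \<Rightarrow> bool" where
  "edge l m \<longleftrightarrow> l \<noteq> m \<and> (\<exists>a. a \<in> l \<and> a \<in> m \<and> w a = 1 \<and> (centre a = l \<or> centre a = m))"

definition meets :: "('a ^ 4) set \<Rightarrow> ('a ^ 4) set \<Rightarrow> bool" where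
  "meets l m \<longleftrightarrow> l \<noteq> m \<and> (\<exists>a. a \<in> l \<and> a \<in> m \<and> w a = 1)"

lemma edge_sym: "edge l m \<Longrightarrow> edge m l"
  by (auto simp: edge_def)

lemma edge_imp_meets: "edge l m \<Longrightarrow> meets l m"
  by (auto simp: edge_def meets_def)

lemma centre: "a \<in> l \<Longrightarrow> l \<in> L \<Longrightarrow> centre a \<in> L \<and> a \<in> centre a"
  unfolding centre_def by (rule someI) blast

text \<open>The three lines share one point \<open>a\<close>, and each edge requires
  \<open>centre a\<close> to be one of its two ends; no line is an end of all three edges.\<close>

lemma triangle_free_edge: "triangle_free L edge"
  unfolding triangle_free_def
proof (intro ballI notI)
  fix l m k assume L: "l \<in> L" "m \<in> L" "k \<in> L" and E: "edge l m \<and> edge m k \<and> edge l k"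
  obtain a where a: "a \<in> l" "a \<in> m" "w a = 1" "centre a = l \<or> centre a = m" and lm: "l \<noteq> m"
    using E by (auto simp: edge_def)
  obtain b where b: "b \<in> l" "b \<in> k" "w b = 1" "centre b = l \<or> centre b = k" and lk: "l \<noteq> k"
    using E by (auto simp: edge_def)
  obtain c where c: "c \<in> m" "c \<in> k" "w c = 1" "centre c = m \<or> centre c = k" and mk: "m \<noteq> k"
    using E by (auto simp: edge_def)
  have "a = b" using triangle_concurrent[OF L lm lk mk] a b c by blast
  moreover have "a = c"
    using triangle_concurrent[OF L(2,1,3) lm[symmetric] mk lk] a b c by blast
  ultimately show False using a b c lm lk mk by auto
qed

lemma card_affine_points_of_line:
  assumes "l \<in> L"
  shows "card {a \<in> l. w a = 1} = CARD('a)"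
proof -
  obtain a where a: "a \<in> l" "w a = 1" using affine assms by blast
  have "bij_betw (\<lambda>d. a + d) {d \<in> l. w d = 0} {a \<in> l. w a = 1}"
    using a assms line(1) line_diff
    by (intro bij_betwI[where g = "\<lambda>b. b - a"]) (auto simp: w_add w_diff vec.subspace_add)
  from bij_betw_same_card[OF this] show ?thesis using card_direction[OF assms] by simp
qed

text \<open>Count the incident pairs of a line and an affine point. Those whose line is the centre
  of the point number \<open>card pts\<close>. Any other pair \<open>(l, a)\<close> stands for the
  edge from \<open>l\<close> to \<open>centre a\<close>, oriented towards the centre.\<close>

lemma card_edges:
  "card {(l, m). l \<in> L \<and> m \<in> L \<and> edge l m} + 2 * card pts = 2 * ((CARD('a) + 1) * CARD('a))"
proof -
  define S where "S = Sigma L (\<lambda>l. {a \<in> l. w a = 1})"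
  have fin: "finite L" using card_L by (intro card_ge_0_finite) simp
  then have finS: "finite S" by (simp add: S_def)
  define S1 where "S1 = {(l, a) \<in> S. centre a \<noteq> l}"
  define S2 where "S2 = {(l, a) \<in> S. centre a = l}"
  define D where "D = {(l, m). l \<in> L \<and> m \<in> L \<and> l \<noteq> m \<and> (\<exists>a. a \<in> l \<and> a \<in> m \<and> w a = 1 \<and> centre a = m)}"
  have "card S = (CARD('a) + 1) * CARD('a)"
    unfolding S_def using card_affine_points_of_line card_L fin by simp
  moreover have "card S = card S1 + card S2"
  proof -
    have "S = S1 \<union> S2" "S1 \<inter> S2 = {}" by (auto simp: S1_def S2_def)
    moreover from this have "finite S1" "finite S2" using finS by auto
    ultimately show ?thesis by (simp add: card_Un_disjoint)
  qed
  moreover have "card S2 = card pts"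
  proof (rule bij_betw_same_card[of snd])
    show "bij_betw snd S2 pts"
      by (intro bij_betwI[where g = "\<lambda>a. (centre a, a)"]) (use centre in \<open>auto simp: S2_def S_def pts_def\<close>)
  qed
  moreover have "card S1 = card D"
  proof (rule bij_betw_same_card)
    let ?h = "\<lambda>p. (fst p, centre (snd p))"
    have S1: "fst p \<in> L" "snd p \<in> fst p" "w (snd p) = 1" "centre (snd p) \<noteq> fst p"
      "centre (snd p) \<in> L" "snd p \<in> centre (snd p)" if "p \<in> S1" for p
    proof -
      obtain l a where p: "p = (l, a)" by (cases p)
      show "fst p \<in> L" "snd p \<in> fst p" "w (snd p) = 1" "centre (snd p) \<noteq> fst p"
        using that by (simp_all add: S1_def S_def p)
      then show "centre (snd p) \<in> L" "snd p \<in> centre (snd p)"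
        using centre[of "snd p" "fst p"] by simp_all
    qed
    \<comment> \<open>Two distinct lines share at most one affine point, so the line and the centre
      determine the point.\<close>
    have "inj_on ?h S1"
    proof (rule inj_onI)
      fix p p' assume p: "p \<in> S1" "p' \<in> S1" "?h p = ?h p'"
      then have eq: "fst p' = fst p" "centre (snd p') = centre (snd p)" by simp_all
      have "snd p = snd p'"
        using meet_unique[of "fst p" "centre (snd p)" "snd p" "snd p'"] S1[OF p(1)] S1[OF p(2)]
        unfolding eq by blast
      then show "p = p'" using eq by (simp add: prod_eq_iff)
    qed
    moreover have "?h ` S1 = D"
    proof
      show "?h ` S1 \<subseteq> D"
      proof (rule image_subsetI)
        fix p assume "p \<in> S1"
        from S1[OF this] show "?h p \<in> D" by (auto simp: D_def)
      qed
      show "D \<subseteq> ?h ` S1"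
      proof
        fix z assume "z \<in> D"
        then obtain l m a where z: "z = (l, m)" and *: "l \<in> L" "m \<in> L" "l \<noteq> m" "a \<in> l" "w a = 1" "centre a = m"
          unfolding D_def by blast
        then have "(l, a) \<in> S1" by (simp add: S1_def S_def)
        then show "z \<in> ?h ` S1" using z * by (intro image_eqI[of _ _ "(l, a)"]) simp_all
      qed
    qed
    ultimately show "bij_betw ?h S1 D" by (simp add: bij_betw_def)
  qed
  moreover have "card {(l, m). l \<in> L \<and> m \<in> L \<and> edge l m} = 2 * card D"
  proof -
    have D_iff: "(l, m) \<in> D \<longleftrightarrow> l \<in> L \<and> m \<in> L \<and> l \<noteq> m \<and> (\<exists>a. a \<in> l \<and> a \<in> m \<and> w a = 1 \<and> centre a = m)"
      for l m by (simp add: D_def)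
    have edge_D: "l \<in> L \<and> m \<in> L \<and> edge l m \<longleftrightarrow> (l, m) \<in> D \<or> (m, l) \<in> D" for l m
      unfolding D_iff edge_def by metis
    have "{(l, m). l \<in> L \<and> m \<in> L \<and> edge l m} = D \<union> D\<inverse>"
      unfolding edge_D by auto
    moreover have "finite D"
    proof (rule finite_subset)
      show "D \<subseteq> L \<times> L" using D_iff by auto
    qed (use fin in simp)
    \<comment> \<open>An edge oriented both ways would need two different centres at its only common
      point.\<close>
    moreover have "D \<inter> D\<inverse> = {}"
    proof -
      have False if D: "(l, m) \<in> D" "(m, l) \<in> D" for l m
      proof -
        obtain a where a: "a \<in> l" "a \<in> m" "w a = 1" "centre a = m" and L: "l \<in> L" "m \<in> L" "l \<noteq> m"
          using D(1) unfolding D_iff by blast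
        obtain b where b: "b \<in> m" "b \<in> l" "w b = 1" "centre b = l"
          using D(2) unfolding D_iff by blast
        have "a = b" using meet_unique[OF L] a b by blast
        then show False using a b L by simp
      qed
      then show ?thesis by auto
    qed
    ultimately show ?thesis by (simp add: card_Un_disjoint)
  qed
  ultimately show ?thesis by linarith
qed

text \<open>If \<open>x\<close> and \<open>y\<close> met in \<open>a\<close>, any common neighbour
  would pass through \<open>a\<close> by concurrency. Both of its edges would be realised there,
  which makes it the centre of \<open>a\<close>. Two different common neighbours cannot both be that
  centre.\<close>

lemma skew_of_common_neighbours:
  assumes L: "x \<in> L" "y \<in> L" "u \<in> L" "v \<in> L" and ne: "x \<noteq> y" "u \<noteq> v"
    and E: "edge x u" "edge x v" "edge y u" "edge y v"
  shows "x \<inter> y = {0}"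
proof -
  have cen: "centre a = z" if z: "z \<in> L" "edge x z" "edge y z" and a: "a \<in> x" "a \<in> y" "w a = 1" for a z
  proof -
    obtain b where b: "b \<in> x" "b \<in> z" "w b = 1" "centre b = x \<or> centre b = z" and xz: "x \<noteq> z"
      using z by (auto simp: edge_def)
    obtain c where c: "c \<in> y" "c \<in> z" "w c = 1" "centre c = y \<or> centre c = z" and yz: "y \<noteq> z"
      using z by (auto simp: edge_def)
    have "a = b" using triangle_concurrent[OF L(1,2) z(1) ne(1) xz yz] a b c by blast
    moreover have "a = c" using triangle_concurrent[OF L(2,1) z(1) ne(1)[symmetric] yz xz] a b c by blast
    ultimately show ?thesis using b c ne by auto
  qed
  have "d = 0" if d: "d \<in> x" "d \<in> y" for d
  proof (cases "w d = 0")
    case True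
    then show ?thesis using direction_unique[OF L(1,2) ne(1) d] by simp
  next
    case False
    let ?a = "inverse (w d) *s d"
    have "?a \<in> x" "?a \<in> y" "w ?a = 1"
      using d L line(1) False by (simp_all add: vec.subspace_scale w_scale)
    then have "u = v" using cen[of u ?a] cen[of v ?a] L E by metis
    then show ?thesis using ne by simp
  qed
  then show ?thesis using vec.subspace_0[OF line(1)] L by blast
qed

text \<open>The full vertices \<open>x\<close>, \<open>y\<close> of one part and \<open>u\<close>,
  \<open>v\<close> of the other form the quadrilateral, and any line meets the two chosen lines of
  the opposite part. The hypothesis \<open>few\<close> is the size bound cleared of its
  denominator.\<close>

lemma skew_quadrilateral:
  assumes few: "4 * card pts + CARD('a)\<^sup>2 + 4 < 4 * ((CARD('a) + 1) * CARD('a))"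
  obtains x y u v where "x \<in> L" "y \<in> L" "u \<in> L" "v \<in> L" "x \<inter> y = {0}" "u \<inter> v = {0}"
    "meets x u" "meets x v" "meets y u" "meets y v"
    "\<And>l. l \<in> L \<Longrightarrow> (meets l x \<and> meets l y) \<or> (meets l u \<and> meets l v)"
proof -
  let ?q = "CARD('a)"
  have fin: "finite L" using card_L by (intro card_ge_0_finite) simp
  have many: "?q\<^sup>2 + 4 < 2 * card {(l, m). l \<in> L \<and> m \<in> L \<and> edge l m}"
    using few card_edges by linarith
  obtain A B where AB: "A \<union> B = L" "A \<inter> B = {}" "independent_in edge A" "independent_in edge B"
    using dense_triangle_free_bipartite[OF fin card_L edge_sym triangle_free_edge many] by blast
  have finAB: "finite A" "finite B" using AB(1) fin by (metis finite_Un)+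
  have cAB: "card A + card B = ?q + 1"
    using card_Un_disjoint[OF finAB AB(2)] AB(1) card_L by simp
  have BA: "B \<union> A = L" and cBA: "card B + card A = ?q + 1"
    using AB cAB by auto
  obtain x y where xy: "x \<in> A" "y \<in> A" "x \<noteq> y" "\<And>z. z \<in> B \<Longrightarrow> edge x z \<and> edge y z"
    using dense_bipartite_full_vertices[OF finAB cAB edge_sym AB(3,4)] many AB(1) by blast
  obtain u v where uv: "u \<in> B" "v \<in> B" "u \<noteq> v" "\<And>z. z \<in> A \<Longrightarrow> edge u z \<and> edge v z"
    using dense_bipartite_full_vertices[OF finAB(2,1) cBA edge_sym AB(4,3)] many BA by blast
  have L: "x \<in> L" "y \<in> L" "u \<in> L" "v \<in> L" using xy uv AB(1) by auto
  show thesis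
  proof (rule that[OF L])
    show "x \<inter> y = {0}" using skew_of_common_neighbours[OF L xy(3) uv(3)] xy(4) uv(1,2) by blast
    show "u \<inter> v = {0}" using skew_of_common_neighbours[OF L(3,4,1,2) uv(3) xy(3)] uv(4) xy(1,2) by blast
    show "meets x u" "meets x v" "meets y u" "meets y v" using xy(4) uv(1,2) edge_imp_meets by blast+
    show "(meets l x \<and> meets l y) \<or> (meets l u \<and> meets l v)" if "l \<in> L" for l
      using that xy(4) uv(4) edge_imp_meets edge_sym AB(1) by blast
  qed
qed

end

subsection \<open>The reguli of a hyperbolic quadric\<close>

text \<open>
  The zeros of \<open>x\<^sub>0 x\<^sub>1 + x\<^sub>2 x\<^sub>3\<close> are the singular matrices with rows \<open>(x\<^sub>0, x\<^sub>2)\<close> and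
  \<open>(- x\<^sub>3, x\<^sub>1)\<close>, hence the products \<open>p q\<^sup>T\<close>. Fixing \<open>p\<close> or \<open>q\<close> gives the two reguli.
\<close>

definition segre :: "'a::field \<times> 'a \<Rightarrow> 'a \<times> 'a \<Rightarrow> 'a ^ 4" where
  "segre p q = (\<chi> i. if i = 0 then fst p * fst q else if i = 1 then snd p * snd q
     else if i = 2 then fst p * snd q else - (snd p * fst q))"

definition det2 :: "'a::field \<times> 'a \<Rightarrow> 'a \<times> 'a \<Rightarrow> 'a" where
  "det2 p q = fst p * snd q - snd p * fst q"

abbreviation standard_form :: "'a::field ^ 4 \<Rightarrow> 'a" where
  "standard_form \<equiv> \<lambda>x. x $ 0 * x $ 1 + x $ 2 * x $ 3"

text \<open>The enumeration in \<open>forall_4\<close> is 1, 2, 3, 4, and 4 equals 0 in this index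
  type.\<close>

lemma forall_4_from_0: "(\<forall>i :: 4. P i) \<longleftrightarrow> P 0 \<and> P 1 \<and> P 2 \<and> P 3"
proof -
  have "(4 :: 4) = 0" using of_nat_eq_0_iff_char_dvd[where 'a = 4, of 4] by simp
  then show ?thesis unfolding forall_4 by metis
qed

lemma vec4_eq_iff: "x = y \<longleftrightarrow> x $ 0 = y $ 0 \<and> x $ 1 = y $ 1 \<and> x $ 2 = y $ 2 \<and> x $ 3 = y $ 3"
  for x y :: "'a ^ 4"
  unfolding vec_eq_iff forall_4_from_0 ..

lemma segre_nth [simp]:
  "segre p q $ 0 = fst p * fst q" "segre p q $ 1 = snd p * snd q"
  "segre p q $ 2 = fst p * snd q" "segre p q $ 3 = - (snd p * fst q)"
  by (simp_all add: segre_def)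

lemma segre_eq_0_iff: "segre p q = 0 \<longleftrightarrow> p = (0, 0) \<or> q = (0, 0)"
  by (cases p; cases q) (auto simp: vec4_eq_iff)

lemma segre_scale_right: "segre p (c * fst q, c * snd q) = c *s segre p q"
  by (simp add: vec4_eq_iff)

lemma segre_scale_left: "segre (c * fst p, c * snd p) q = c *s segre p q"
  by (simp add: vec4_eq_iff)

text \<open>The determinant of a sum of two rank-one matrices is the product of the determinants of
  the column pair and the row pair. So the sum of two zeros is a zero only if their left or their
  right factors are proportional.\<close>

lemma standard_form_segre_add:
  "standard_form (segre p q + segre p' q') = det2 p p' * det2 q q'"
  by (simp add: det2_def algebra_simps)

text \<open>A singular matrix is a column times a row; the cases are a first row with nonzero first
  entry, a zero first row, and a zero first column.\<close>

lemma standard_form_zeroE: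
  assumes "standard_form x = 0"
  obtains p q where "x = segre p q"
proof (cases "x $ 0 = 0")
  case False
  have "x $ 1 = - x $ 3 / x $ 0 * x $ 2"
    using assms False by (simp add: field_simps eq_neg_iff_add_eq_0)
  then have "x = segre (1, - x $ 3 / x $ 0) (x $ 0, x $ 2)"
    using False by (simp add: vec4_eq_iff)
  then show thesis by (rule that)
next
  case x0: True
  show thesis
  proof (cases "x $ 2 = 0")
    case True
    have "x = segre (0, 1) (- x $ 3, x $ 1)" using x0 True by (simp add: vec4_eq_iff)
    then show thesis by (rule that)
  next
    case False
    then have "x = segre (x $ 2, x $ 1) (0, 1)" using x0 assms by (simp add: vec4_eq_iff)
    then show thesis by (rule that)
  qed
qed

lemma segre_eqD:
  assumes "segre p q = segre p' q'" "segre p' q' \<noteq> 0"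
  shows "det2 p p' = 0" "det2 q q' = 0"
proof -
  obtain a b c d a' b' c' d' where pq: "p = (a, b)" "q = (c, d)" "p' = (a', b')" "q' = (c', d')"
    by (cases p; cases q; cases p'; cases q')
  have eq: "a * c = a' * c'" "b * d = b' * d'" "a * d = a' * d'" "b * c = b' * c'"
    using assms(1) by (simp_all add: pq vec4_eq_iff)
  have nz: "a' \<noteq> 0 \<or> b' \<noteq> 0" "c' \<noteq> 0 \<or> d' \<noteq> 0"
    using assms(2) by (auto simp: segre_eq_0_iff pq)
  have "(a * b' - b * a') * c' = 0" "(a * b' - b * a') * d' = 0"
    using eq by algebra+
  then show "det2 p p' = 0" using nz by (auto simp: det2_def pq)
  have "(c * d' - d * c') * a' = 0" "(c * d' - d * c') * b' = 0"
    using eq by algebra+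
  then show "det2 q q' = 0" using nz by (auto simp: det2_def pq)
qed

lemma det2_eq_0D:
  assumes "det2 p p' = 0" "p \<noteq> (0, 0)"
  obtains c where "p' = (c * fst p, c * snd p)"
proof (cases "fst p = 0")
  case True
  then have "snd p \<noteq> 0" using assms(2) by (auto simp: prod_eq_iff)
  then show thesis using that[of "snd p' / snd p"] assms(1) True by (simp add: det2_def prod_eq_iff)
next
  case False
  then show thesis using that[of "fst p' / fst p"] assms(1) by (simp add: det2_def prod_eq_iff field_simps)
qed

definition left_line :: "'a::field \<times> 'a \<Rightarrow> ('a ^ 4) set" where
  "left_line p = range (segre p)"

definition right_line :: "'a::field \<times> 'a \<Rightarrow> ('a ^ 4) set" where
  "right_line q = range (\<lambda>p. segre p q)"

lemma left_line_in_pg_lines: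
  assumes "p \<noteq> (0, 0)"
  shows "left_line p \<in> pg_lines"
proof -
  have "left_line p = vec.span {segre p (1, 0), segre p (0, 1)}"
  proof -
    have "segre p q = fst q *s segre p (1, 0) + snd q *s segre p (0, 1)" for q
      by (simp add: vec4_eq_iff)
    moreover have "i *s segre p (1, 0) + j *s segre p (0, 1) = segre p (i, j)" for i j
      by (simp add: vec4_eq_iff)
    ultimately show ?thesis unfolding left_line_def span_pair by blast
  qed
  moreover have "segre p (1, 0) \<noteq> 0" "segre p (0, 1) \<noteq> k *s segre p (1, 0)" for k
    using assms by (cases p; auto simp: segre_eq_0_iff vec4_eq_iff)+
  ultimately show ?thesis by (simp add: pg_lines_def dim_span_pair del: vec.dim_span)
qed

lemma right_line_in_pg_lines:
  assumes "q \<noteq> (0, 0)"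
  shows "right_line q \<in> pg_lines"
proof -
  have "right_line q = vec.span {segre (1, 0) q, segre (0, 1) q}"
  proof -
    have "segre p q = fst p *s segre (1, 0) q + snd p *s segre (0, 1) q" for p
      by (simp add: vec4_eq_iff)
    moreover have "i *s segre (1, 0) q + j *s segre (0, 1) q = segre (i, j) q" for i j
      by (simp add: vec4_eq_iff)
    ultimately show ?thesis unfolding right_line_def span_pair by blast
  qed
  moreover have "segre (1, 0) q \<noteq> 0" "segre (0, 1) q \<noteq> k *s segre (1, 0) q" for k
    using assms by (cases q; auto simp: segre_eq_0_iff vec4_eq_iff)+
  ultimately show ?thesis by (simp add: pg_lines_def dim_span_pair del: vec.dim_span)
qed

text \<open>Normalised representatives of the points of the projective line, which index each
  regulus.\<close>

definition directions :: "('a::field \<times> 'a) set" where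
  "directions = insert (0, 1) (range (Pair 1))"

lemma card_directions: "card (directions :: ('a::{field,finite} \<times> 'a) set) = CARD('a) + 1"
  unfolding directions_def by (subst card_insert_disjoint) (auto simp: card_image inj_on_def)

lemma directions_nonzero: "p \<in> directions \<Longrightarrow> p \<noteq> (0, 0)"
  by (auto simp: directions_def)

lemma directions_det2: "p \<in> directions \<Longrightarrow> p' \<in> directions \<Longrightarrow> det2 p p' = 0 \<Longrightarrow> p = p'"
  by (auto simp: directions_def det2_def)

lemma directions_cover:
  assumes "p \<noteq> (0, 0)"
  obtains c p' where "p' \<in> directions" "p = (c * fst p', c * snd p')"
proof (cases "fst p = 0")
  case True
  then show thesis using that[of "(0, 1)" "snd p"] by (simp add: directions_def prod_eq_iff)
next
  case False
  then show thesis using that[of "(1, snd p / fst p)" "fst p"] by (simp add: directions_def prod_eq_iff)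
qed

text \<open>Two independent vectors of \<open>l\<close> and their sum are all zeros, so the product
  of the two determinants vanishes and both vectors lie on a common left or right line. Equal
  dimensions then give equality.\<close>

lemma line_of_standard_quadric:
  assumes l: "l \<in> pg_lines" and zero: "\<And>x. x \<in> l \<Longrightarrow> standard_form x = 0"
  shows "l \<in> left_line ` directions \<union> right_line ` directions"
proof -
  have sub: "vec.subspace l" and dim: "vec.dim l = 2" using l by (auto simp: pg_lines_def)
  have "l \<noteq> {0}" using dim by auto
  then obtain a where a: "a \<in> l" "a \<noteq> 0" using vec.subspace_0[OF sub] by blast
  have "\<not> l \<subseteq> vec.span {a}" using vec.dim_mono[of l "{a}"] dim a by auto
  then obtain b where b: "b \<in> l" "b \<notin> vec.span {a}" by blast
  then have bk: "b \<noteq> k *s a" for k by (auto simp: vec.span_singleton)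
  have gen: "l \<subseteq> m" if m: "m \<in> pg_lines" "a \<in> m" "b \<in> m" for m
  proof
    fix x assume "x \<in> l"
    then obtain i j where "x = i *s a + j *s b" using span_pairD[OF sub dim a(1) b(1) a(2) bk] by blast
    then show "x \<in> m" using m by (simp add: pg_lines_def vec.subspace_add vec.subspace_scale)
  qed
  have eq: "l = m" if m: "m \<in> pg_lines" "a \<in> m" "b \<in> m" for m
    using vec.subspace_dim_equal[OF sub _ gen[OF m]] m(1) dim by (simp add: pg_lines_def)
  obtain p q where pq: "a = segre p q" using standard_form_zeroE zero a by blast
  obtain p' q' where pq': "b = segre p' q'" using standard_form_zeroE zero b by blast
  have nz: "p \<noteq> (0, 0)" "q \<noteq> (0, 0)" using a pq by (auto simp: segre_eq_0_iff)
  have "standard_form (a + b) = 0" using zero[of "a + b"] a b sub by (simp add: vec.subspace_add)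
  then have "det2 p p' * det2 q q' = 0"
    unfolding pq pq' standard_form_segre_add .
  then consider "det2 p p' = 0" | "det2 q q' = 0" by auto
  then show ?thesis
  proof cases
    case 1
    obtain c r where r: "r \<in> directions" "p = (c * fst r, c * snd r)" using directions_cover[OF nz(1)] by blast
    obtain d where "p' = (d * fst p, d * snd p)" using det2_eq_0D[OF 1 nz(1)] by blast
    then have "p' = (d * c * fst r, d * c * snd r)" using r by (simp add: mult.assoc)
    then have "b = segre r (d * c * fst q', d * c * snd q')" "a = segre r (c * fst q, c * snd q)"
      using pq pq' r by (simp_all only: segre_scale_left segre_scale_right)
    then have "l = left_line r"
      using left_line_in_pg_lines[OF directions_nonzero[OF r(1)]] by (intro eq) (auto simp: left_line_def)
    then show ?thesis using r(1) by blast
  next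
    case 2
    obtain c r where r: "r \<in> directions" "q = (c * fst r, c * snd r)" using directions_cover[OF nz(2)] by blast
    obtain d where "q' = (d * fst q, d * snd q)" using det2_eq_0D[OF 2 nz(2)] by blast
    then have "q' = (d * c * fst r, d * c * snd r)" using r by (simp add: mult.assoc)
    then have "b = segre (d * c * fst p', d * c * snd p') r" "a = segre (c * fst p, c * snd p) r"
      using pq pq' r by (simp_all only: segre_scale_left segre_scale_right)
    then have "l = right_line r"
      using right_line_in_pg_lines[OF directions_nonzero[OF r(1)]] by (intro eq) (auto simp: right_line_def)
    then show ?thesis using r(1) by blast
  qed
qed

lemma lines_of_zero_points:
  assumes scale: "\<And>c x. F x = 0 \<Longrightarrow> F (c *s x) = 0" and "F 0 = 0"
  shows "lines_of (zero_points F) = {l \<in> pg_lines. \<forall>x\<in>l. F x = 0}"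
proof (intro set_eqI iffI)
  fix l assume l: "l \<in> lines_of (zero_points F)"
  have "F x = 0" if x: "x \<in> l" for x
  proof (cases "x = 0")
    case False
    have "vec.span {x} \<in> pg_points" using False by (simp add: pg_points_def)
    moreover have "vec.span {x} \<subseteq> l"
      using l x by (intro vec.span_minimal) (auto simp: lines_of_def pg_lines_def)
    ultimately have "vec.span {x} \<in> zero_points F" using l by (simp add: lines_of_def)
    then show ?thesis using vec.span_base[of x "{x}"] by (simp add: zero_points_def)
  qed (simp add: assms)
  then show "l \<in> {l \<in> pg_lines. \<forall>x\<in>l. F x = 0}" using l by (simp add: lines_of_def)
qed (auto simp: lines_of_def zero_points_def)

lemma reguli_of_standard_quadric:
  "reguli_of (zero_points (standard_form :: 'a::{field,finite} ^ 4 \<Rightarrow> 'a))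
     (left_line ` directions) (right_line ` directions)"
proof -
  let ?Q = "zero_points (standard_form :: 'a ^ 4 \<Rightarrow> 'a)"
  have lines: "lines_of ?Q = {l \<in> pg_lines. \<forall>x\<in>l. standard_form x = 0}"
    by (rule lines_of_zero_points) (auto simp: algebra_simps simp flip: distrib_left)
  have LR: "left_line p \<inter> left_line p' = {0}" if "p \<in> directions" "p' \<in> directions" "p \<noteq> p'"
    for p p' :: "'a \<times> 'a"
  proof -
    have "x = 0" if "x \<in> left_line p" "x \<in> left_line p'" for x
      using that segre_eqD(1) directions_det2 \<open>p \<in> directions\<close> \<open>p' \<in> directions\<close> \<open>p \<noteq> p'\<close>
      unfolding left_line_def by (metis imageE)
    moreover have "0 \<in> left_line r" for r :: "'a \<times> 'a"
      unfolding left_line_def using segre_eq_0_iff[of r "(0, 0)"] by (metis rangeI)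
    ultimately show ?thesis by blast
  qed
  have RR: "right_line p \<inter> right_line p' = {0}" if "p \<in> directions" "p' \<in> directions" "p \<noteq> p'"
    for p p' :: "'a \<times> 'a"
  proof -
    have "x = 0" if "x \<in> right_line p" "x \<in> right_line p'" for x
      using that segre_eqD(2) directions_det2 \<open>p \<in> directions\<close> \<open>p' \<in> directions\<close> \<open>p \<noteq> p'\<close>
      unfolding right_line_def by (metis imageE)
    moreover have "0 \<in> right_line r" for r :: "'a \<times> 'a"
      unfolding right_line_def using segre_eq_0_iff[of "(0, 0)" r] by (metis rangeI)
    ultimately show ?thesis by blast
  qed
  have nontriv: "l \<noteq> {0}" if "l \<in> pg_lines" for l :: "('a ^ 4) set"
    using that by (auto simp: pg_lines_def)
  have inj: "inj_on left_line (directions :: ('a \<times> 'a) set)"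
    using LR nontriv[OF left_line_in_pg_lines[OF directions_nonzero]] unfolding inj_on_def by fastforce
  have inj': "inj_on right_line (directions :: ('a \<times> 'a) set)"
    using RR nontriv[OF right_line_in_pg_lines[OF directions_nonzero]] unfolding inj_on_def by fastforce
  have ne: "left_line p \<noteq> right_line q" if pq: "p \<in> directions" "q \<in> directions" for p q :: "'a \<times> 'a"
  proof
    assume eq: "left_line p = right_line q"
    \<comment> \<open>Since \<open>r\<close> is independent of \<open>q\<close>, the vector
      \<open>segre p r\<close> lies on the left line but not on the right one.\<close>
    obtain r where r: "r \<noteq> (0, 0)" "det2 r q \<noteq> 0"
    proof (cases "fst q = 0")
      case True
      then show thesis using that[of "(1, 0)"] directions_nonzero[OF pq(2)] by (auto simp: det2_def prod_eq_iff)
    next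
      case False
      then show thesis using that[of "(0, 1)"] by (simp add: det2_def)
    qed
    have "segre p r \<in> right_line q" using eq unfolding left_line_def by blast
    then obtain s where s: "segre p r = segre s q" by (auto simp: right_line_def)
    moreover have "segre p r \<noteq> 0" using r directions_nonzero[OF pq(1)] by (simp add: segre_eq_0_iff)
    ultimately show False using segre_eqD(2) r by metis
  qed
  have meet: "left_line p \<inter> right_line q \<noteq> {0}" if pq: "p \<in> directions" "q \<in> directions" for p q :: "'a \<times> 'a"
  proof -
    have "segre p q \<in> left_line p \<inter> right_line q" by (auto simp: left_line_def right_line_def)
    moreover have "segre p q \<noteq> 0" using pq directions_nonzero by (metis segre_eq_0_iff)
    ultimately show ?thesis by blast
  qed
  have "left_line ` directions \<union> right_line ` directions = lines_of ?Q"
  proof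
    show "lines_of ?Q \<subseteq> left_line ` directions \<union> right_line ` directions"
      unfolding lines using line_of_standard_quadric by blast
    show "left_line ` directions \<union> right_line ` directions \<subseteq> lines_of ?Q"
    proof -
      have "x $ 0 * x $ 1 + x $ 2 * x $ 3 = 0" if "x \<in> left_line p \<union> right_line p" for x and p :: "'a \<times> 'a"
        using that by (auto simp: left_line_def right_line_def)
      then show ?thesis
        unfolding lines using left_line_in_pg_lines[OF directions_nonzero]
          right_line_in_pg_lines[OF directions_nonzero] by auto
    qed
  qed
  then show ?thesis
    unfolding reguli_of_def
  proof (intro conjI)
    show "left_line ` directions \<inter> right_line ` directions = ({} :: ('a ^ 4) set set)"
      using ne by blast
    show "card (left_line ` directions :: ('a ^ 4) set set) = CARD('a) + 1"
      "card (right_line ` directions :: ('a ^ 4) set set) = CARD('a) + 1"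
      using inj inj' by (simp_all add: card_image card_directions)
    show "\<forall>l\<in>left_line ` directions. \<forall>m\<in>left_line ` directions. l \<noteq> m \<longrightarrow> l \<inter> m = {0 :: 'a ^ 4}"
      using LR by (metis imageE)
    show "\<forall>l\<in>right_line ` directions. \<forall>m\<in>right_line ` directions. l \<noteq> m \<longrightarrow> l \<inter> m = {0 :: 'a ^ 4}"
      using RR by (metis imageE)
    show "\<forall>l\<in>left_line ` directions. \<forall>m\<in>right_line ` directions. l \<inter> m \<noteq> {0 :: 'a ^ 4}"
      using meet by (metis imageE)
  qed
qed

text \<open>The conditions in \<open>reguli_of\<close> involve only inclusion, intersection,
  cardinality and dimension, all preserved by an invertible linear map.\<close>

lemma reguli_of_image:
  fixes M :: "'a::{field,finite} ^ 4 ^ 4"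
  assumes M: "invertible M" and reg: "reguli_of Q R R'"
  defines "f \<equiv> \<lambda>S. (\<lambda>x. M *v x) ` S"
  shows "reguli_of (f ` Q) (f ` R) (f ` R')"
proof -
  let ?M = "\<lambda>x. M *v x"
  obtain N where "M ** N = mat 1" "N ** M = mat 1" using M by (auto simp: invertible_def)
  then have "M *v (N *v x) = x" "N *v (M *v x) = x" for x
    by (simp_all add: matrix_vector_mul_assoc)
  then have inj: "inj ?M" and surj: "surj ?M" by (metis injI, metis surjI)
  have f_inj: "inj f" unfolding f_def using inj by (auto simp: inj_def inj_image_eq_iff)
  have dim: "vec.dim (f S) = vec.dim S" for S
    unfolding f_def by (rule vec.dim_image_eq) (use inj in \<open>auto simp: inj_on_def inj_def\<close>)
  have sub: "vec.subspace (f S) \<longleftrightarrow> vec.subspace S" for S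
  proof
    show "vec.subspace S \<Longrightarrow> vec.subspace (f S)"
      unfolding f_def by (rule vec.subspace_image)
    assume "vec.subspace (f S)"
    then have "vec.subspace (?M -` f S)" by (rule vec.subspace_vimage)
    then show "vec.subspace S" unfolding f_def using inj by (simp add: inj_vimage_image_eq)
  qed
  have f_surj: "\<exists>S. T = f S" for T
    unfolding f_def using surj by (metis surj_image_vimage_eq)
  have f_all: "(\<forall>T. \<Phi> T) \<longleftrightarrow> (\<forall>S. \<Phi> (f S))" for \<Phi>
  proof
    assume *: "\<forall>S. \<Phi> (f S)"
    show "\<forall>T. \<Phi> T"
    proof
      fix T obtain S where "T = f S" using f_surj by blast
      then show "\<Phi> T" using * by simp
    qed
  qed simp
  have sset: "f S \<subseteq> f T \<longleftrightarrow> S \<subseteq> T" for S T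
    unfolding f_def using inj by (simp add: inj_image_subset_iff)
  have fInt: "f S \<inter> f T = f (S \<inter> T)" for S T
    unfolding f_def using inj by (simp add: image_Int)
  have f0: "f S = {0} \<longleftrightarrow> S = {0}" for S
  proof -
    have "f {0} = {0}" by (simp add: f_def)
    then show ?thesis using f_inj by (metis injD)
  qed
  have pts: "f P \<in> pg_points \<longleftrightarrow> P \<in> pg_points" and lns: "f P \<in> pg_lines \<longleftrightarrow> P \<in> pg_lines" for P
    by (simp_all add: pg_points_def pg_lines_def dim sub)
  have mem: "f P \<in> f ` X \<longleftrightarrow> P \<in> X" for P X
    using f_inj by (simp add: inj_image_mem_iff)
  have lines: "f l \<in> lines_of (f ` Q) \<longleftrightarrow> l \<in> lines_of Q" for l
  proof -
    have "(\<forall>P\<in>pg_points. P \<subseteq> f l \<longrightarrow> P \<in> f ` Q) \<longleftrightarrow> (\<forall>P\<in>pg_points. P \<subseteq> l \<longrightarrow> P \<in> Q)"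
    proof -
      have "(\<forall>P. P \<in> pg_points \<longrightarrow> P \<subseteq> f l \<longrightarrow> P \<in> f ` Q)
          \<longleftrightarrow> (\<forall>S. f S \<in> pg_points \<longrightarrow> f S \<subseteq> f l \<longrightarrow> f S \<in> f ` Q)"
        by (rule f_all)
      then show ?thesis unfolding pts sset mem Ball_def .
    qed
    then show ?thesis by (simp add: lines_of_def lns)
  qed
  have "f ` lines_of Q = lines_of (f ` Q)"
  proof (intro set_eqI)
    fix l obtain m where "l = f m" using f_surj by blast
    then show "l \<in> f ` lines_of Q \<longleftrightarrow> l \<in> lines_of (f ` Q)" by (simp add: lines mem)
  qed
  moreover have "card (f ` X) = card X" for X
    using f_inj by (simp add: card_image inj_on_subset)
  moreover have "f ` R \<inter> f ` R' = {}"
    using reg image_Int[OF f_inj, of R R'] by (simp add: reguli_of_def)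
  ultimately show ?thesis
    using reg f_inj unfolding reguli_of_def
    by (simp add: fInt f0 inj_eq flip: image_Un)
qed

lemma hyperbolic_quadric_reguli:
  fixes Q :: "('a::{field,finite} ^ 4) set set"
  assumes "hyperbolic_quadric Q"
  obtains R R' where "reguli_of Q R R'"
  using assms reguli_of_image[OF _ reguli_of_standard_quadric] unfolding hyperbolic_quadric_def by blast

subsection \<open>The quadric through a Kakeya line set\<close>

lemma zero_points_image:
  fixes M N :: "'a::field ^ 4 ^ 4"
  assumes MN: "M ** N = mat 1" "N ** M = mat 1"
  shows "(\<lambda>P. (\<lambda>x. M *v x) ` P) ` zero_points F = zero_points (\<lambda>x. F (N *v x))"
proof -
  have inv: "M *v (N *v x) = x" "N *v (M *v x) = x" for x
    using MN by (simp_all add: matrix_vector_mul_assoc)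
  have pt: "(\<lambda>x. A *v x) ` P \<in> pg_points" if P: "P \<in> pg_points" and inj: "inj ((*v) A)"
    for P and A :: "'a ^ 4 ^ 4"
    using P vec.dim_image_eq[of "(*v) A" P] inj
    by (auto simp: pg_points_def vec.subspace_image inj_on_subset)
  have injs: "inj ((*v) M)" "inj ((*v) N)" using inv by (metis injI)+
  show ?thesis
  proof (intro set_eqI iffI)
    fix P assume "P \<in> (\<lambda>P. (\<lambda>x. M *v x) ` P) ` zero_points F"
    then show "P \<in> zero_points (\<lambda>x. F (N *v x))"
      using pt injs inv by (auto simp: zero_points_def)
  next
    fix P assume P: "P \<in> zero_points (\<lambda>x. F (N *v x))"
    have "P = (\<lambda>x. M *v x) ` ((\<lambda>x. N *v x) ` P)" by (simp add: image_image inv)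
    moreover have "(\<lambda>x. N *v x) ` P \<in> zero_points F" using P pt injs by (auto simp: zero_points_def)
    ultimately show "P \<in> (\<lambda>P. (\<lambda>x. M *v x) ` P) ` zero_points F" by blast
  qed
qed

definition vec4 :: "'a \<Rightarrow> 'a \<Rightarrow> 'a \<Rightarrow> 'a \<Rightarrow> 'a ^ 4" where
  "vec4 a b c d = (\<chi> i. if i = 0 then a else if i = 1 then b else if i = 2 then c else d)"

lemma vec4_nth [simp]:
  "vec4 a b c d $ 0 = a" "vec4 a b c d $ 1 = b" "vec4 a b c d $ 2 = c" "vec4 a b c d $ 3 = d"
  by (simp_all add: vec4_def)

lemma sum_4_from_0: "sum f (UNIV :: 4 set) = f 0 + f 1 + f 2 + f 3"
proof -
  have "(4 :: 4) = 0" using of_nat_eq_0_iff_char_dvd[where 'a = 4, of 4] by simp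
  then have "f 4 = f 0" by metis
  then show ?thesis by (simp only: sum_4 add_ac)
qed

lemma basis_matrix:
  fixes e0 e1 e2 e3 :: "'a::field ^ 4"
  assumes "\<And>i j k l. i *s e0 + j *s e1 + k *s e2 + l *s e3 = 0 \<Longrightarrow> i = 0 \<and> j = 0 \<and> k = 0 \<and> l = 0"
  obtains M N :: "'a ^ 4 ^ 4" where "M ** N = mat 1" "N ** M = mat 1"
    "\<forall>x. M *v x = x $ 0 *s e0 + x $ 1 *s e1 + x $ 2 *s e2 + x $ 3 *s e3"
proof -
  define M :: "'a ^ 4 ^ 4" where "M = (\<chi> i j. vec4 (e0 $ i) (e1 $ i) (e2 $ i) (e3 $ i) $ j)"
  have Mv: "M *v x = x $ 0 *s e0 + x $ 1 *s e1 + x $ 2 *s e2 + x $ 3 *s e3" for x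
    by (simp add: M_def matrix_vector_mult_def vec_eq_iff sum_4_from_0 mult.commute)
  have "x = 0" if "M *v x = 0" for x
    using assms[of "x $ 0" "x $ 1" "x $ 2" "x $ 3"] that by (simp add: Mv vec4_eq_iff)
  then obtain N :: "'a ^ 4 ^ 4" where "N ** M = mat 1"
    using matrix_left_invertible_ker[of M] by blast
  moreover from this have "M ** N = mat 1" by (simp add: matrix_left_right_inverse)
  ultimately show thesis using that Mv by blast
qed

lemma quadratic_map_standard: "quadratic_map (standard_form :: 'a::field ^ 4 \<Rightarrow> 'a)"
  by standard (simp_all add: polar_def power2_eq_square algebra_simps)

lemma quadratic_map_comp:
  assumes "quadratic_map F"
  shows "quadratic_map (\<lambda>x. F (N *v x))"
proof -
  interpret quadratic_map F by fact
  have "polar (\<lambda>x. F (N *v x)) u v = polar F (N *v u) (N *v v)" for u v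
    by (simp add: polar_def vec.add)
  then show ?thesis
    by unfold_locales (simp_all add: vec.add vec.scale scale polar_add polar_scale)
qed

section \<open>The member of the pencil of quadrics that contains the conic\<close>

context conic_lines
begin

text \<open>
  Restricted to the plane \<open>\<Sum> x\<^sub>i = 0\<close>, a quadratic form is \<open>- (\<Sum>i<j. x\<^sub>i x\<^sub>j F (e\<^sub>i - e\<^sub>j))\<close>.
\<close>

lemma F_on_plane:
  assumes s: "s + i + j + k = 0"
    and z: "F (e0 - e2) = 0" "F (e0 - e3) = 0" "F (e1 - e2) = 0" "F (e1 - e3) = 0"
  shows "F (s *s e0 + i *s e1 + j *s e2 + k *s e3) = - (s * i * F (e0 - e1) + j * k * F (e2 - e3))"
proof -
  have "s = - i - j - k" using s by (simp add: algebra_simps eq_neg_iff_add_eq_0)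
  then have eq: "s *s e0 + i *s e1 + j *s e2 + k *s e3
      = i *s (e1 - e0) + (j *s (e2 - e0) + k *s (e3 - e0))"
    by (simp only:) (simp add: algebra_simps)
  have P: "polar F (a - c) (b - c) = F (a - c) + F (b - c) - F (a - b)" for a b c
    using diff[of "a - c" "b - c"] by simp
  have m: "F (a - b) = F (b - a)" for a b using uminus[of "a - b"] by simp
  have "F (i *s a + (j *s b + k *s c)) = i\<^sup>2 * F a + j\<^sup>2 * F b + k\<^sup>2 * F c
      + i * j * polar F a b + i * k * polar F a c + j * k * polar F b c" for a b c
    by (simp add: add[of "i *s a"] lincomb scale polar_add_right polar_scale polar_scale_right algebra_simps)
  from this[of "e1 - e0" "e2 - e0" "e3 - e0"]
  have "F (i *s (e1 - e0) + (j *s (e2 - e0) + k *s (e3 - e0))) =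
      i\<^sup>2 * F (e0 - e1) + i * j * F (e0 - e1) + i * k * F (e0 - e1) - j * k * F (e2 - e3)"
    unfolding P m[of e1 e0] m[of e2 e0] m[of e3 e0] z by simp
  also have "\<dots> = - (s * i * F (e0 - e1) + j * k * F (e2 - e3))"
    unfolding \<open>s = - i - j - k\<close> by (simp add: power2_eq_square algebra_simps)
  finally show ?thesis using eq by simp
qed

text \<open>Three points suffice: \<open>a\<close>, \<open>b\<close> and the point at infinity
  spanned by \<open>a - b\<close>. The last zero makes \<open>polar G a b\<close> vanish, and then
  \<open>G\<close> vanishes on all combinations.\<close>

lemma quadratic_zero_on_line:
  assumes G: "quadratic_map G" and G0: "\<And>d. w d = 0 \<Longrightarrow> F d = 0 \<Longrightarrow> G d = 0"
    and l: "l \<in> L" and ab: "a \<in> l" "b \<in> l" "w a = 1" "w b = 1" "a \<noteq> b" "G a = 0" "G b = 0" and x: "x \<in> l"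
  shows "G x = 0"
proof -
  interpret G: quadratic_map G by fact
  have "G (a - b) = 0" using G0 direction[OF l] line_diff[OF l] ab by (simp add: w_diff)
  then have "polar G a b = 0" using G.diff[of a b] ab by simp
  moreover have "b \<noteq> k *s a" for k
  proof
    assume "b = k *s a"
    then show False using ab w_scale[of k a] by simp
  qed
  moreover have "a \<noteq> 0" using ab(3) w_scale[of 0 0] by auto
  ultimately show ?thesis
    using span_pairD[OF line[OF l] ab(1,2) _ _ x] ab G.lincomb
    by (metis add_0 mult_zero_right)
qed

text \<open>In the basis of the four vertices, the forms vanishing on the sides of the quadrilateral
  are the combinations of the two products of opposite coordinates. Matching one of them with
  \<open>F\<close> at infinity gives the quadric.\<close>

lemma quadric_through_lines:
  assumes few: "4 * card pts + CARD('a)\<^sup>2 + 4 < 4 * ((CARD('a) + 1) * CARD('a))"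
  obtains Q where "hyperbolic_quadric Q" "L \<subseteq> lines_of Q"
    "\<And>P. (\<And>x. x \<in> P \<Longrightarrow> w x = 0) \<Longrightarrow> P \<in> Q \<longleftrightarrow> P \<in> zero_points F"
proof -
  obtain x y u v where L: "x \<in> L" "y \<in> L" "u \<in> L" "v \<in> L" and xy: "x \<inter> y = {0}" and uv: "u \<inter> v = {0}"
    and "meets x u" "meets x v" "meets y u" "meets y v"
    and cover: "\<And>l. l \<in> L \<Longrightarrow> (meets l x \<and> meets l y) \<or> (meets l u \<and> meets l v)"
    using skew_quadrilateral[OF few] by blast
  \<comment> \<open>The pairs \<open>e0\<close>, \<open>e1\<close> and \<open>e2\<close>,
    \<open>e3\<close> are opposite vertices, as the products in the standard form require.\<close>
  then obtain e0 e1 e2 e3 where e0: "e0 \<in> x" "e0 \<in> u" "w e0 = 1" and e2: "e2 \<in> x" "e2 \<in> v" "w e2 = 1"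
    and e3: "e3 \<in> y" "e3 \<in> u" "w e3 = 1" and e1: "e1 \<in> y" "e1 \<in> v" "w e1 = 1"
    unfolding meets_def by metis
  have nz: "e \<noteq> 0" if "w e = 1" for e using that w_scale[of 0 0] by auto
  have sub: "i *s a + j *s b \<in> l" if "l \<in> L" "a \<in> l" "b \<in> l" for i j a b l
    using that line(1) by (simp add: vec.subspace_add vec.subspace_scale)
  have sub1: "i *s a \<in> l" if "l \<in> L" "a \<in> l" for i a l
    using that line(1) by (simp add: vec.subspace_scale)
  have two: "i = 0 \<and> j = 0" if "i *s a + j *s b = 0" "a \<in> l" "b \<in> m" "l \<inter> m = {0}" "w a = 1" "w b = 1"
    "l \<in> L" "m \<in> L" for i j a b l m
  proof -
    have eq: "i *s a = (- j) *s b" using that(1) by (simp add: eq_neg_iff_add_eq_0)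
    then have "i *s a \<in> l \<inter> m" using sub1[OF \<open>l \<in> L\<close> \<open>a \<in> l\<close>, of i] sub1[OF \<open>m \<in> L\<close> \<open>b \<in> m\<close>, of "- j"] by simp
    then have "i *s a = 0" "(- j) *s b = 0" using that(4) eq by auto
    then show ?thesis using nz that(5,6) by auto
  qed
  \<comment> \<open>Skewness of \<open>x\<close> and \<open>y\<close> separates \<open>e0\<close>,
    \<open>e2\<close> from \<open>e1\<close>, \<open>e3\<close>; skewness of \<open>u\<close> and
    \<open>v\<close> then splits either pair.\<close>
  have indep: "i = 0 \<and> j = 0 \<and> k = 0 \<and> l = 0" if z: "i *s e0 + j *s e1 + k *s e2 + l *s e3 = 0" for i j k l
  proof -
    have eq: "i *s e0 + k *s e2 = (- j) *s e1 + (- l) *s e3"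
      using z by (simp add: eq_neg_iff_add_eq_0 algebra_simps)
    have "i *s e0 + k *s e2 \<in> x" using sub[OF L(1) e0(1) e2(1)] .
    moreover have "i *s e0 + k *s e2 \<in> y" unfolding eq using sub[OF L(2) e1(1) e3(1)] .
    ultimately have "i *s e0 + k *s e2 = 0" using xy by blast
    moreover from this have "(- j) *s e1 + (- l) *s e3 = 0" using eq by simp
    ultimately show ?thesis
      using two[OF _ e0(2) e2(2) uv e0(3) e2(3) L(3,4)] two[OF _ e1(2) e3(2) _ e1(3) e3(3) L(4,3)] uv
      by (metis Int_commute neg_equal_0_iff_equal)
  qed
  have side: "F (a - b) = 0" if "l \<in> L" "a \<in> l" "b \<in> l" "w a = 1" "w b = 1" for a b l
    using direction[OF that(1)] line_diff that by (simp add: w_diff)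
  have z: "F (e0 - e2) = 0" "F (e0 - e3) = 0" "F (e1 - e2) = 0" "F (e1 - e3) = 0"
    using side L e0 e1 e2 e3 by blast+
  have m: "F (a - b) = F (b - a)" for a b using uminus[of "a - b"] by simp
  define \<alpha> where "\<alpha> = F (e0 - e1)"
  define \<beta> where "\<beta> = F (e2 - e3)"
  \<comment> \<open>Otherwise the direction of the diagonal \<open>e0 - e1\<close> and those of the
    sides \<open>x\<close> and \<open>v\<close> would be three collinear points of the conic. The
    argument for \<open>\<beta>\<close> uses the other diagonal with \<open>x\<close> and
    \<open>u\<close>.\<close>
  have "\<alpha> \<noteq> 0"
  proof
    assume l0: "\<alpha> = 0"
    have "(e0 - e1) - (e0 - e2) = e2 - e1" by simp
    then have "polar F (e0 - e1) (e0 - e2) = 0"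
      using diff[of "e0 - e1" "e0 - e2"] l0 z m[of e1 e2] by (simp add: \<alpha>_def)
    moreover have "e0 - e1 \<noteq> 0" using indep[of 1 "-1" 0 0] by auto
    ultimately obtain k where "e0 - e2 = k *s (e0 - e1)"
      using polar_nonzero[of "e0 - e1" "e0 - e2"] l0 z e0 e1 e2 by (auto simp: w_diff \<alpha>_def)
    then have "(1 - k) *s e0 + k *s e1 + (- 1) *s e2 + 0 *s e3 = 0" by (simp add: algebra_simps)
    then show False using indep by fastforce
  qed
  have "\<beta> \<noteq> 0"
  proof
    assume l0: "\<beta> = 0"
    have "(e2 - e3) - (e2 - e0) = e0 - e3" by simp
    then have "polar F (e2 - e3) (e2 - e0) = 0"
      using diff[of "e2 - e3" "e2 - e0"] l0 z m[of e0 e2] by (simp add: \<beta>_def)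
    moreover have "e2 - e3 \<noteq> 0" using indep[of 0 0 1 "-1"] by auto
    ultimately obtain k where "e2 - e0 = k *s (e2 - e3)"
      using polar_nonzero[of "e2 - e3" "e2 - e0"] l0 z m[of e0 e2] e0 e3 e2 by (auto simp: w_diff \<beta>_def)
    then have "(- 1) *s e0 + 0 *s e1 + (1 - k) *s e2 + k *s e3 = 0" by (simp add: algebra_simps)
    then show False using indep by fastforce
  qed
  \<comment> \<open>Scaling \<open>e0\<close> by \<open>c\<close> gives both products of opposite
    coordinates the same weight \<open>\<beta>\<close> in \<open>F\<close> at infinity; this selects
    the member of the pencil.\<close>
  define c where "c = \<beta> / \<alpha>"
  have c: "c \<noteq> 0" "c * \<alpha> = \<beta>" using \<open>\<alpha> \<noteq> 0\<close> \<open>\<beta> \<noteq> 0\<close> by (simp_all add: c_def)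
  have indep': "i = 0 \<and> j = 0 \<and> k = 0 \<and> l = 0" if "i *s (c *s e0) + j *s e1 + k *s e2 + l *s e3 = 0" for i j k l
    using indep[of "i * c" j k l] that c by simp
  obtain M N :: "'a ^ 4 ^ 4" where MN: "M ** N = mat 1" "N ** M = mat 1"
    and "\<forall>x. M *v x = x $ 0 *s (c *s e0) + x $ 1 *s e1 + x $ 2 *s e2 + x $ 3 *s e3"
    using basis_matrix[OF indep'] by blast
  then have Mv: "M *v x = x $ 0 *s (c *s e0) + x $ 1 *s e1 + x $ 2 *s e2 + x $ 3 *s e3" for x by blast
  define G where "G x = standard_form (N *v x)" for x
  have G: "quadratic_map G"
    unfolding G_def using quadratic_map_comp[OF quadratic_map_standard] .
  interpret G: quadratic_map G by fact
  have GM: "G (M *v x) = standard_form x" for x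
    unfolding G_def using MN by (simp add: matrix_vector_mul_assoc)
  \<comment> \<open>As \<open>w\<close> is 1 at every vertex, \<open>w x = 0\<close> says that the
    coordinates with respect to the unscaled vertices sum to 0, the condition in
    \<open>F_on_plane\<close>.\<close>
  have FG: "F x = - \<beta> * G x" if "w x = 0" for x
  proof -
    define X where "X = N *v x"
    have x: "x = M *v X" unfolding X_def using MN by (simp add: matrix_vector_mul_assoc)
    have "X $ 0 * c + X $ 1 + X $ 2 + X $ 3 = 0"
      using that e0 e1 e2 e3 by (simp add: x Mv w_add w_scale)
    from F_on_plane[OF this z] have "F x = - (X $ 0 * c * X $ 1 * \<alpha> + X $ 2 * X $ 3 * \<beta>)"
      by (simp add: x Mv \<alpha>_def \<beta>_def)
    also have "\<dots> = - \<beta> * standard_form X" using c(2)[symmetric] by (simp add: algebra_simps)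
    finally show ?thesis by (simp add: x GM)
  qed
  then have FG0: "F x = 0 \<longleftrightarrow> G x = 0" if "w x = 0" for x using that \<open>\<beta> \<noteq> 0\<close> by simp
  have Ge: "G e0 = 0" "G e1 = 0" "G e2 = 0" "G e3 = 0"
  proof -
    have "M *v vec4 (1 / c) 0 0 0 = e0" "M *v vec4 0 1 0 0 = e1" "M *v vec4 0 0 1 0 = e2" "M *v vec4 0 0 0 1 = e3"
      using c by (simp_all add: Mv)
    then show "G e0 = 0" "G e1 = 0" "G e2 = 0" "G e3 = 0"
      using GM[of "vec4 (1 / c) 0 0 0"] GM[of "vec4 0 1 0 0"] GM[of "vec4 0 0 1 0"] GM[of "vec4 0 0 0 1"]
      by simp_all
  qed
  have ne: "e0 \<noteq> e2" "e0 \<noteq> e3" "e1 \<noteq> e2" "e1 \<noteq> e3"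
    using indep[of 1 0 "-1" 0] indep[of 1 0 0 "-1"] indep[of 0 1 "-1" 0] indep[of 0 1 0 "-1"] by auto
  note on_line = quadratic_zero_on_line[OF G FG0[THEN iffD1]]
  have Gx: "G a = 0" if "a \<in> x" for a using on_line[OF _ _ L(1) e0(1) e2(1)] e0 e2 ne Ge that by blast
  have Gu: "G a = 0" if "a \<in> u" for a using on_line[OF _ _ L(3) e0(2) e3(2)] e0 e3 ne Ge that by blast
  have Gv: "G a = 0" if "a \<in> v" for a using on_line[OF _ _ L(4) e1(2) e2(2)] e1 e2 ne Ge that by blast
  have Gy: "G a = 0" if "a \<in> y" for a using on_line[OF _ _ L(2) e1(1) e3(1)] e1 e3 ne Ge that by blast
  \<comment> \<open>Because \<open>m\<close> and \<open>n\<close> are skew, the points where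
    \<open>l\<close> meets them are distinct, as the three-point argument requires.\<close>
  have pair: "G p = 0" if l: "l \<in> L" "p \<in> l" and lmn: "meets l m" "meets l n" and mn: "m \<inter> n = {0}"
    and "\<And>a. a \<in> m \<Longrightarrow> G a = 0" "\<And>a. a \<in> n \<Longrightarrow> G a = 0" for l m n p
  proof -
    obtain a b where a: "a \<in> l" "a \<in> m" "w a = 1" and b: "b \<in> l" "b \<in> n" "w b = 1"
      using lmn unfolding meets_def by blast
    have "a \<noteq> b" using a b mn nz by blast
    then show ?thesis using on_line[OF _ _ l(1) a(1) b(1)] a b that by blast
  qed
  have GL: "G p = 0" if "l \<in> L" "p \<in> l" for l p
    using cover[OF that(1)] pair[OF that] Gx Gy Gu Gv xy uv by blast
  define Q where "Q = zero_points G"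
  show thesis
  proof (rule that)
    have "Q = (\<lambda>P. (\<lambda>x. M *v x) ` P) ` zero_points standard_form"
      unfolding Q_def zero_points_image[OF MN] G_def ..
    moreover have "invertible M" unfolding invertible_def using MN by blast
    ultimately show "hyperbolic_quadric Q" unfolding hyperbolic_quadric_def by blast
    have "lines_of Q = {l \<in> pg_lines. \<forall>x\<in>l. G x = 0}"
      unfolding Q_def by (rule lines_of_zero_points) (simp_all add: G.scale)
    then show "L \<subseteq> lines_of Q" using GL line by (auto simp: pg_lines_def)
    show "P \<in> Q \<longleftrightarrow> P \<in> zero_points F" if "\<And>x. x \<in> P \<Longrightarrow> w x = 0" for P
      using FG0 that by (auto simp: Q_def zero_points_def)
  qed
qed

end

section \<open>From projective subspaces to vectors, and the choice of the two sets of
  directions\<close>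

theorem theorem3p5:
  fixes \<pi> :: "('a::{field,finite} ^ 4) set"
    and C L :: "('a ^ 4) set set"
  assumes "even CARD('a)"
    and "\<pi> \<in> pg_planes"
    and "nonsingular_conic \<pi> C"
    and "kakeya_line_set \<pi> C L"
    and "real (card (kakeya_set \<pi> L)) < 3 / 4 * real CARD('a) ^ 2 + real CARD('a) - 1"
  shows "\<exists>Q R R' A B.
    hyperbolic_quadric Q \<and> {P \<in> Q. P \<subseteq> \<pi>} = C \<and> reguli_of Q R R' \<and>
    A \<union> B = C \<and> A \<inter> B = {} \<and>
    kakeya_line_set \<pi> C (lines_through R A \<union> lines_through R' B) \<and>
    kakeya_set \<pi> L = kakeya_set \<pi> (lines_through R A \<union> lines_through R' B)"
proof -
  have char2: "x + x = 0" for x :: 'a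
    using double_eq_0_of_even_card assms(1) by blast
  have plane: "vec.subspace \<pi>" "vec.dim \<pi> = 3" using assms(2) by (auto simp: pg_planes_def)
  obtain F where "quadratic_form F" and ns: "nonsingular_on \<pi> F" and C: "C = {P \<in> zero_points F. P \<subseteq> \<pi>}"
    using assms(3) by (auto simp: nonsingular_conic_def)
  then have F: "quadratic_map F" by (simp add: quadratic_map_of_form)
  obtain w :: "'a ^ 4 \<Rightarrow> 'a" where w_add: "\<And>a b. w (a + b) = w a + w b"
    and w_scale: "\<And>c a. w (c *s a) = c * w a" and w: "\<And>x. x \<in> \<pi> \<longleftrightarrow> w x = 0"
    using plane_functional[OF plane] by blast
  have L_lines: "l \<in> pg_lines" "\<not> l \<subseteq> \<pi>" "l \<inter> \<pi> \<in> C" if "l \<in> L" for l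
    using that assms(4)
    by (auto simp: kakeya_line_set_def linear_representation_lines_def affine_lines_def)
  have L_unique: "\<exists>!l. l \<in> L \<and> P \<subseteq> l" if "P \<in> C" for P
    using that assms(4) by (auto simp: kakeya_line_set_def)
  have C_points: "P \<in> pg_points" "P \<subseteq> \<pi>" "\<And>x. x \<in> P \<Longrightarrow> F x = 0" if "P \<in> C" for P
    using that by (auto simp: C zero_points_def)
  have at_infinity: "{d \<in> l. w d = 0} = l \<inter> \<pi>" for l using w by auto
  have dir_eq: "l \<inter> \<pi> = P" if lP: "l \<in> L" "P \<in> C" "P \<subseteq> l" for l P
  proof -
    have P: "P \<in> pg_points" using C_points(1) lP by blast
    then have "P \<noteq> {0}" "0 \<in> P" by (auto simp: pg_points_def vec.subspace_0)
    then obtain v where v: "v \<in> P" "v \<noteq> 0" by blast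
    have "v \<in> l \<inter> \<pi>" using v C_points(2) lP by blast
    then show ?thesis
      using point_eq_span[OF C_points(1)[OF L_lines(3)[OF lP(1)]]] point_eq_span[OF P] v by simp
  qed
  interpret conic_lines F w L
  proof (intro conic_lines.intro conic_lines_axioms.intro F w_add w_scale)
    show "\<exists>k. d' = k *s d" if "w d = 0" "w d' = 0" "F d = 0" "F d' = 0" "polar F d d' = 0" "d \<noteq> 0" for d d'
      using polar_nonzero_on_conic[OF F char2 plane ns] that w by blast
    show "vec.subspace l" "vec.dim l = 2" if "l \<in> L" for l
      using L_lines(1)[OF that] by (auto simp: pg_lines_def)
    show "\<exists>a\<in>l. w a = 1" if l: "l \<in> L" for l
    proof -
      obtain a where a: "a \<in> l" "w a \<noteq> 0" using L_lines(2)[OF l] w by blast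
      then have "inverse (w a) *s a \<in> l" "w (inverse (w a) *s a) = 1"
        using L_lines(1)[OF l] by (auto simp: pg_lines_def vec.subspace_scale w_scale)
      then show ?thesis by blast
    qed
    show "F d = 0" if "l \<in> L" "d \<in> l" "w d = 0" for l d
      using C_points(3)[OF L_lines(3)[OF that(1)]] that w by blast
    show "card {d \<in> l. w d = 0} = CARD('a)" if "l \<in> L" for l
      using C_points(1)[OF L_lines(3)[OF that]] card_subspace[of "l \<inter> \<pi>"]
      by (simp add: at_infinity pg_points_def)
    show "d = 0" if "l \<in> L" "m \<in> L" "l \<noteq> m" "d \<in> l" "d \<in> m" "w d = 0" for l m d
    proof (rule ccontr)
      assume "d \<noteq> 0"
      then have "l \<inter> \<pi> = vec.span {d}" "m \<inter> \<pi> = vec.span {d}"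
        using point_eq_span[OF C_points(1)[OF L_lines(3)]] that w by blast+
      then have "l \<inter> \<pi> \<subseteq> m" by blast
      then show False using L_unique[OF L_lines(3)[OF that(1)]] that by blast
    qed
    \<comment> \<open>Taking points at infinity transfers the count of the conic to
      \<open>L\<close>.\<close>
    have "bij_betw (\<lambda>l. l \<inter> \<pi>) L C"
    proof (rule bij_betwI')
      fix l m assume "l \<in> L" "m \<in> L"
      then show "l \<inter> \<pi> = m \<inter> \<pi> \<longleftrightarrow> l = m"
        using L_unique[OF L_lines(3)[of l]] by blast
    next
      show "l \<inter> \<pi> \<in> C" if "l \<in> L" for l using L_lines(3) that .
    next
      show "\<exists>l\<in>L. P = l \<inter> \<pi>" if "P \<in> C" for P using L_unique[OF that] dir_eq that by metis
    qed
    then have "card L = card C" by (rule bij_betw_same_card)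
    then show "card L = CARD('a) + 1"
      using card_nonsingular_conic[OF F char2 plane ns] by (simp add: C)
  qed
  have L_pg: "l \<in> pg_lines" if "l \<in> L" for l using L_lines that by blast
  \<comment> \<open>Each affine point is spanned by exactly one vector at which \<open>w\<close> is
    1.\<close>
  have "bij_betw (\<lambda>a. vec.span {a}) pts (kakeya_set \<pi> L)"
  proof (rule bij_betw_imageI)
    show "inj_on (\<lambda>a. vec.span {a}) pts"
    proof (rule inj_onI)
      fix a b assume ab: "a \<in> pts" "b \<in> pts" "vec.span {a} = vec.span {b}"
      then have "a \<in> vec.span {b}" using vec.span_base[of a "{a}"] by simp
      then obtain k where "a = k *s b" by (auto simp: vec.span_singleton)
      then show "a = b" using ab w_scale[of k b] by (simp add: pts_def)
    qed
    show "(\<lambda>a. vec.span {a}) ` pts = kakeya_set \<pi> L"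
    proof (intro set_eqI iffI)
      fix P assume "P \<in> (\<lambda>a. vec.span {a}) ` pts"
      then obtain a l where P: "P = vec.span {a}" and a: "w a = 1" "a \<in> l" "l \<in> L"
        by (auto simp: pts_def)
      have "a \<noteq> 0" using a(1) w_scale[of 0 0] by auto
      moreover have "\<not> P \<subseteq> \<pi>" using a(1) w[of a] vec.span_base[of a "{a}"] P by auto
      moreover have "P \<subseteq> l" unfolding P using a L_pg by (intro vec.span_minimal) (auto simp: pg_lines_def)
      ultimately show "P \<in> kakeya_set \<pi> L"
        using a(3) by (auto simp: kakeya_set_def affine_points_def pg_points_def P)
    next
      fix P assume "P \<in> kakeya_set \<pi> L"
      then obtain l where P: "P \<in> pg_points" "\<not> P \<subseteq> \<pi>" and l: "l \<in> L" "P \<subseteq> l"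
        by (auto simp: kakeya_set_def affine_points_def)
      then obtain b where b: "b \<in> P" "w b \<noteq> 0" using w by blast
      let ?a = "inverse (w b) *s b"
      have a: "?a \<in> P" "w ?a = 1" using b P by (simp_all add: pg_points_def vec.subspace_scale w_scale)
      then have "?a \<noteq> 0" using w_scale[of 0 0] by auto
      then have "P = vec.span {?a}" using point_eq_span P a by blast
      moreover have "?a \<in> pts" using a l by (auto simp: pts_def)
      ultimately show "P \<in> (\<lambda>a. vec.span {a}) ` pts" by blast
    qed
  qed
  then have K: "card (kakeya_set \<pi> L) = card pts" by (metis bij_betw_same_card)
  \<comment> \<open>Four times the bound is \<open>3 * q^2 + 4 * q - 4\<close>; adding
    \<open>q^2 + 4\<close> gives the right-hand side.\<close>
  have "real (4 * card pts + CARD('a)\<^sup>2 + 4) < real (4 * ((CARD('a) + 1) * CARD('a)))"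
    using assms(5) by (simp add: K power2_eq_square algebra_simps)
  then have few: "4 * card pts + CARD('a)\<^sup>2 + 4 < 4 * ((CARD('a) + 1) * CARD('a))"
    by (simp only: of_nat_less_iff)
  obtain Q where Q: "hyperbolic_quadric Q" and LQ: "L \<subseteq> lines_of Q"
    and Q\<pi>: "\<And>P. (\<And>x. x \<in> P \<Longrightarrow> w x = 0) \<Longrightarrow> P \<in> Q \<longleftrightarrow> P \<in> zero_points F"
    using quadric_through_lines[OF few] by blast
  have QC: "{P \<in> Q. P \<subseteq> \<pi>} = C"
    unfolding C using Q\<pi> w by blast
  obtain R R' where R: "reguli_of Q R R'" using hyperbolic_quadric_reguli[OF Q] by blast
  then have RR': "R \<union> R' = lines_of Q" "R \<inter> R' = {}"
    by (simp_all add: reguli_of_def)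
  have skew: "l \<inter> m = {0}" if "S = R \<or> S = R'" "l \<in> S" "m \<in> S" "l \<noteq> m" for l m S
    using R[unfolded reguli_of_def] that by (elim disjE conjE) simp_all
  \<comment> \<open>By uniqueness of the line of \<open>L\<close> through a direction, the
    directions left for \<open>B\<close> are those whose line lies in \<open>R'\<close>.\<close>
  define A where "A = {P \<in> C. \<exists>l\<in>L. P \<subseteq> l \<and> l \<in> R}"
  define B where "B = C - A"
  \<comment> \<open>Lines of one regulus are pairwise disjoint, so \<open>l\<close> is the only line
    of its regulus through \<open>P\<close>.\<close>
  have through: "m \<in> L" if "l \<in> L" "P \<in> C" "P \<subseteq> l" "P \<subseteq> m" "l \<in> S" "m \<in> S" "S = R \<or> S = R'" for l m P S
  proof -
    have "P \<noteq> {0}" using C_points(1)[OF that(2)] by (auto simp: pg_points_def)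
    moreover have "0 \<in> P" using C_points(1)[OF that(2)] by (auto simp: pg_points_def vec.subspace_0)
    ultimately have "l \<inter> m \<noteq> {0}" using that(3,4) by blast
    then have "l = m" using skew[OF that(7,5,6)] by blast
    then show ?thesis using that by simp
  qed
  \<comment> \<open>The prescribed lines are \<open>L\<close> itself, so the Kakeya property and the
    covered points carry over at once.\<close>
  have L_eq: "lines_through R A \<union> lines_through R' B = L"
  proof (intro set_eqI iffI)
    fix m assume "m \<in> lines_through R A \<union> lines_through R' B"
    then show "m \<in> L"
    proof
      assume "m \<in> lines_through R A"
      then obtain P l where "m \<in> R" "P \<subseteq> m" "P \<in> C" "l \<in> L" "P \<subseteq> l" "l \<in> R"
        by (auto simp: lines_through_def A_def)
      then show ?thesis using through by blast
    next
      assume "m \<in> lines_through R' B"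
      then obtain P where P: "m \<in> R'" "P \<subseteq> m" "P \<in> C" "P \<notin> A"
        by (auto simp: lines_through_def B_def)
      obtain l where l: "l \<in> L" "P \<subseteq> l" using L_unique[OF P(3)] by blast
      then have "l \<in> R'" using P LQ RR'(1) unfolding A_def by blast
      then show ?thesis using through P l by blast
    qed
  next
    fix l assume l: "l \<in> L"
    let ?P = "l \<inter> \<pi>"
    have P: "?P \<in> C" using L_lines(3)[OF l] .
    have "l \<in> R \<or> l \<in> R'" using l LQ RR'(1) by blast
    then show "l \<in> lines_through R A \<union> lines_through R' B"
    proof
      assume "l \<in> R"
      then have "?P \<in> A" using P l unfolding A_def by blast
      then show ?thesis using \<open>l \<in> R\<close> unfolding lines_through_def by blast
    next
      assume "l \<in> R'"
      then have "l \<notin> R" using RR'(2) by blast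
      then have "?P \<notin> A" using L_unique[OF P] l unfolding A_def by blast
      then have "?P \<in> B" using P by (simp add: B_def)
      then show ?thesis using \<open>l \<in> R'\<close> unfolding lines_through_def by blast
    qed
  qed
  have "A \<union> B = C" "A \<inter> B = {}" by (auto simp: A_def B_def)
  then show ?thesis
    using Q QC R assms(4) by (intro exI[of _ Q] exI[of _ R] exI[of _ R'] exI[of _ A] exI[of _ B] conjI)
      (simp_all only: L_eq)
qed

end
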